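(* Let $k,\ell\in\mathbb N$. If $G$ is a finite graph that has tree-width $<k$ and no geodesic cycle longer than $\ell$, and $G$ is not a forest, then the tree-length of $G$ is at most $\ell(k-2)$.
   Context: Graphs are simple and undirected. A tree-decomposition of a graph $G=(V,E)$ is a pair $(T,(V_t)_{t\in T})$ of a tree $T$ and a family of vertex sets $V_t\subseteq V$ (its parts), indexed by the nodes of $T$, such that (T1) $V=\bigcup_t V_t$; (T2) for every edge of $G$ some $V_t$ contains both its ends; (T3) $V_{t_1}\cap V_{t_3}\subseteq V_{t_2}$ whenever $t_2$ lies on the path between $t_1$ and $t_3$ in $T$. Its width is $\max_t|V_t|-1$, and the tree-width of $G$ is the minimum width of a tree-decomposition of $G$. The tree-length of $G$ is the smallest value, minimized over all tree-decompositions of $G$, of the maximum distance $d_G(u,v)$ in $G$ (not in the subgraph induced by the part) between any two vertices $u,v$ lying in a common part of the decomposition. A subgraph $H\subseteq G$ is geodesic if $d_H(x,y)=d_G(x,y)$ for all vertices $x,y$ of $H$, where $d$ denotes the length (number of edges) of a shortest path in the respective graph. A geodesic cycle is a cycle in $G$ that is a geodesic subgraph. *)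

theory Defs
  imports "Graph_Theory.Graph_Theory" "HOL-Library.Extended_Nat"
begin

text \<open>
  A simple undirected graph is a symmetric loop-free relation on its vertex set
  (\<^locale>\<open>pair_bidirected_digraph\<close>); the locale \<^locale>\<open>pair_graph\<close> adds finiteness.
  Every edge is thus present as two opposite arcs, so the library's
  \<^const>\<open>pre_digraph.cycle\<close>, \<^const>\<open>forest\<close> and \<^const>\<open>tree\<close> count the closed walk
  \<open>a, b, a\<close> as a cycle. In an undirected graph cycles have at least three edges.
\<close>

definition ucycle :: "'a pair_pre_digraph \<Rightarrow> ('a \<times> 'a) awalk \<Rightarrow> bool" where
  "ucycle G c \<longleftrightarrow> pre_digraph.cycle (with_proj G) c \<and> 3 \<le> length c"

definition uforest :: "'a pair_pre_digraph \<Rightarrow> bool" where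
  "uforest G \<longleftrightarrow> pair_bidirected_digraph G \<and> \<not> (\<exists>c. ucycle G c)"

definition utree :: "'a pair_pre_digraph \<Rightarrow> bool" where
  "utree T \<longleftrightarrow> uforest T \<and> connected (with_proj T)"

text \<open>Distance is \<open>\<infinity>\<close> between vertices in different components.\<close>

definition gdist :: "'a pair_pre_digraph \<Rightarrow> 'a \<Rightarrow> 'a \<Rightarrow> enat" where
  "gdist G u v = (INF p \<in> {p. pre_digraph.apath (with_proj G) u p v}. enat (length p))"

definition geodesic :: "'a pair_pre_digraph \<Rightarrow> 'a pair_pre_digraph \<Rightarrow> bool" where
  "geodesic H G \<longleftrightarrow> pair_bidirected_digraph H \<and> subgraph (with_proj H) (with_proj G) \<and>
     (\<forall>x \<in> pverts H. \<forall>y \<in> pverts H. gdist H x y = gdist G x y)"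

text \<open>The subgraph formed by the vertices and edges of a closed walk.\<close>

definition cycle_subgraph :: "('a \<times> 'a) awalk \<Rightarrow> 'a pair_pre_digraph" where
  "cycle_subgraph c = \<lparr> pverts = fst ` set c, parcs = set c \<union> (set c)\<inverse> \<rparr>"

definition geodesic_cycle :: "'a pair_pre_digraph \<Rightarrow> ('a \<times> 'a) awalk \<Rightarrow> bool" where
  "geodesic_cycle G c \<longleftrightarrow> ucycle G c \<and> geodesic (cycle_subgraph c) G"

definition tree_decomposition ::
    "'a pair_pre_digraph \<Rightarrow> 't pair_pre_digraph \<Rightarrow> ('t \<Rightarrow> 'a set) \<Rightarrow> bool" where
  "tree_decomposition G T P \<longleftrightarrow>
     utree T \<and>
     pverts G = (\<Union>t \<in> pverts T. P t) \<and>
     (\<forall>(u, v) \<in> parcs G. \<exists>t \<in> pverts T. u \<in> P t \<and> v \<in> P t) \<and>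
     (\<forall>t1 t2 t3 p. pre_digraph.apath (with_proj T) t1 p t3 \<and> t2 \<in> set (pawalk_verts t1 p)
        \<longrightarrow> P t1 \<inter> P t3 \<subseteq> P t2)"

text \<open>
  The width is an integer, since it is \<open>-1\<close> if all parts are empty. The maximum exists for
  every tree-decomposition of a finite graph, even one with infinitely many nodes.
\<close>

definition td_width :: "'t pair_pre_digraph \<Rightarrow> ('t \<Rightarrow> 'a set) \<Rightarrow> int" where
  "td_width T P = int (Max ((\<lambda>t. card (P t)) ` pverts T)) - 1"

definition td_length ::
    "'a pair_pre_digraph \<Rightarrow> 't pair_pre_digraph \<Rightarrow> ('t \<Rightarrow> 'a set) \<Rightarrow> enat" where
  "td_length G T P = (SUP t \<in> pverts T. SUP u \<in> P t. SUP v \<in> P t. gdist G u v)"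

text \<open>
  HOL cannot quantify over the node type of \<open>T\<close> inside a definition, so the nodes are natural
  numbers. For finite \<open>G\<close> this loses nothing: choose finitely many nodes of \<open>T\<close> whose parts cover
  all vertices and edges of \<open>G\<close>. Restricting the decomposition to the finite subtree they span
  increases neither its width nor its length.
\<close>

definition treewidth :: "'a pair_pre_digraph \<Rightarrow> int" where
  "treewidth G =
     Inf {td_width T P | (T :: nat pair_pre_digraph) P. tree_decomposition G T P}"

definition treelength :: "'a pair_pre_digraph \<Rightarrow> enat" where
  "treelength G =
     Inf {td_length G T P | (T :: nat pair_pre_digraph) P. tree_decomposition G T P}"

end

theory Submission
  imports Defs
begin

text \<open>
  A tree-decomposition of width less than \<open>k\<close> yields a chordal completion of \<open>G\<close> whose cliques have at
  most \<open>k\<close> vertices; let \<open>H\<close> be a minimal chordal completion contained in it. The maximal cliques of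
  \<open>H\<close> are the parts of a tree-decomposition, so it suffices to bound \<open>d\<^sub>G(u, v)\<close> for every edge \<open>uv\<close> of
  \<open>H\<close>. If \<open>uv\<close> is not an edge of \<open>G\<close>, minimality gives a set \<open>S\<close> of fewer than \<open>k\<close> vertices
  containing \<open>u\<close> and \<open>v\<close> and two disjoint connected sets \<open>C\<close>, \<open>C'\<close>, both adjacent to \<open>u\<close> and \<open>v\<close>, such
  that \<open>S\<close> is the neighbourhood of \<open>C\<close>. For every partition of \<open>S\<close> into \<open>A\<close> containing \<open>u\<close> and \<open>B\<close>
  containing \<open>v\<close>, some closed walk through \<open>C\<close> and \<open>C'\<close> uses an odd number of \<open>A\<close>-\<open>C\<close> edges. A shortest
  such walk is a geodesic cycle, and it meets \<open>B\<close> since it crosses the boundary of \<open>C\<close> evenly often; so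
  \<open>A\<close> and \<open>B\<close> have distance at most \<open>l\<close>. Growing \<open>A\<close> from \<open>{u}\<close> reaches \<open>v\<close> after at most
  \<open>|S| - 1 \<le> k - 2\<close> steps.
\<close>

section \<open>Chordal graphs by clique separations\<close>

definition clique :: "'a rel \<Rightarrow> 'a set \<Rightarrow> bool" where
  "clique H K \<longleftrightarrow> (\<forall>x\<in>K. \<forall>y\<in>K. x \<noteq> y \<longrightarrow> (x, y) \<in> H)"

definition separation :: "'a set \<Rightarrow> 'a rel \<Rightarrow> 'a set \<Rightarrow> 'a set \<Rightarrow> bool" where
  "separation V H X Y \<longleftrightarrow> X \<union> Y = V \<and> (\<forall>x\<in>X - Y. \<forall>y\<in>Y - X. (x, y) \<notin> H)"

text \<open>Dirac's characterisation of the absence of induced cycles of length at least four. \<open>H\<close> may have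
  arcs outside \<open>V\<close>, which makes the notion hereditary in \<open>V\<close> for fixed \<open>H\<close>.\<close>

definition chordal :: "'a set \<Rightarrow> 'a rel \<Rightarrow> bool" where
  "chordal V H \<longleftrightarrow> (\<forall>x\<in>V. \<forall>y\<in>V. x \<noteq> y \<longrightarrow> (x, y) \<notin> H \<longrightarrow>
     (\<exists>X Y. separation V H X Y \<and> clique H (X \<inter> Y) \<and> x \<in> X - Y \<and> y \<in> Y - X))"

lemma cliqueD: "clique H K \<Longrightarrow> x \<in> K \<Longrightarrow> y \<in> K \<Longrightarrow> x \<noteq> y \<Longrightarrow> (x, y) \<in> H"
  by (auto simp: clique_def)

lemma clique_subset: "clique H K \<Longrightarrow> L \<subseteq> K \<Longrightarrow> clique H L"
  by (auto simp: clique_def)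

lemma clique_insert:
  assumes "clique H K" "sym H" "\<And>y. y \<in> K \<Longrightarrow> y \<noteq> x \<Longrightarrow> (x, y) \<in> H"
  shows "clique H (insert x K)"
  using assms by (auto simp: clique_def dest: symD)

lemma separation_sym: "separation V H X Y \<Longrightarrow> sym H \<Longrightarrow> separation V H Y X"
  unfolding separation_def by (auto dest: symD)

lemma separation_arc:
  "separation V H X Y \<Longrightarrow> sym H \<Longrightarrow> (x, y) \<in> H \<Longrightarrow> x \<in> V \<Longrightarrow> y \<in> V \<Longrightarrow>
    x \<in> X \<and> y \<in> X \<or> x \<in> Y \<and> y \<in> Y"
  unfolding separation_def by (auto dest: symD)

lemma clique_in_side:
  assumes "separation V H X Y" "sym H" "clique H K" "K \<subseteq> V"
  shows "K \<subseteq> X \<or> K \<subseteq> Y"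
proof (rule ccontr)
  assume "\<not> ?thesis"
  then obtain a b where ab: "a \<in> K" "a \<notin> X" "b \<in> K" "b \<notin> Y" by auto
  then have "a \<in> Y - X" "b \<in> X - Y" using assms unfolding separation_def by blast+
  then show False using ab cliqueD[OF assms(3), of b a] assms(1) unfolding separation_def by blast
qed

lemma chordal_subset:
  assumes "chordal V H" "W \<subseteq> V"
  shows "chordal W H"
  unfolding chordal_def
proof (intro ballI impI)
  fix x y assume xy: "x \<in> W" "y \<in> W" "x \<noteq> y" "(x, y) \<notin> H"
  then obtain X Y where "separation V H X Y" "clique H (X \<inter> Y)" "x \<in> X - Y" "y \<in> Y - X"
    using assms unfolding chordal_def by (meson subsetD)
  then show "\<exists>X Y. separation W H X Y \<and> clique H (X \<inter> Y) \<and> x \<in> X - Y \<and> y \<in> Y - X"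
    using xy assms(2)
    by (intro exI[of _ "X \<inter> W"] exI[of _ "Y \<inter> W"]) (auto simp: separation_def clique_def)
qed

text \<open>The clique \<open>A \<inter> B\<close> falls into one side of any clique separation of
  \<open>A\<close>, so all of \<open>B\<close> can be added to that side; likewise with
  \<open>A\<close> and \<open>B\<close> exchanged. Vertices from different sides are separated by
  \<open>A\<close> and \<open>B\<close> themselves.\<close>

lemma chordal_glue:
  fixes H :: "'a rel"
  assumes "chordal A H" "chordal B H" "sym H" "clique H (A \<inter> B)"
  shows "chordal (A \<union> B) (H \<inter> (A \<times> A \<union> B \<times> B))"
proof -
  have one_side: "\<exists>X Y. separation (A \<union> B) (H \<inter> (A \<times> A \<union> B \<times> B)) X Y \<and>
      clique (H \<inter> (A \<times> A \<union> B \<times> B)) (X \<inter> Y) \<and> x \<in> X - Y \<and> y \<in> Y - X"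
    if AB: "chordal A H" "clique H (A \<inter> B)" "x \<in> A" "y \<in> A" "x \<noteq> y" "(x, y) \<notin> H"
    for A B :: "'a set" and x y
  proof -
    obtain X Y where XY: "separation A H X Y" "clique H (X \<inter> Y)" "x \<in> X - Y" "y \<in> Y - X"
      using AB unfolding chordal_def by meson
    have "A \<inter> B \<subseteq> X \<or> A \<inter> B \<subseteq> Y"
      using clique_in_side[OF XY(1) assms(3) AB(2)] by auto
    then show ?thesis
    proof
      assume "A \<inter> B \<subseteq> X"
      then have sub: "z \<in> X" if "z \<in> A" "z \<in> B" for z using that by auto
      have "separation (A \<union> B) (H \<inter> (A \<times> A \<union> B \<times> B)) (X \<union> B) (Y)"
        using XY(1) sub unfolding separation_def by blast
      moreover have "(X \<union> B) \<inter> (Y) = X \<inter> Y" "X \<inter> Y \<subseteq> A"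
        using XY(1) sub unfolding separation_def by auto
      moreover have "x \<in> (X \<union> B) - (Y)" "y \<in> (Y) - (X \<union> B)"
        using XY sub unfolding separation_def by auto
      moreover have "clique (H \<inter> (A \<times> A \<union> B \<times> B)) (X \<inter> Y)"
        using XY(2) \<open>X \<inter> Y \<subseteq> A\<close> unfolding clique_def by blast
      ultimately show ?thesis by metis
    next
      assume "A \<inter> B \<subseteq> Y"
      then have sub: "z \<in> Y" if "z \<in> A" "z \<in> B" for z using that by auto
      have "separation (A \<union> B) (H \<inter> (A \<times> A \<union> B \<times> B)) (X) (Y \<union> B)"
        using XY(1) sub unfolding separation_def by blast
      moreover have "(X) \<inter> (Y \<union> B) = X \<inter> Y" "X \<inter> Y \<subseteq> A"
        using XY(1) sub unfolding separation_def by auto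
      moreover have "x \<in> (X) - (Y \<union> B)" "y \<in> (Y \<union> B) - (X)"
        using XY sub unfolding separation_def by auto
      moreover have "clique (H \<inter> (A \<times> A \<union> B \<times> B)) (X \<inter> Y)"
        using XY(2) \<open>X \<inter> Y \<subseteq> A\<close> unfolding clique_def by blast
      ultimately show ?thesis by metis
    qed
  qed
  show ?thesis unfolding chordal_def
  proof (intro ballI impI)
    fix x y assume xy: "x \<in> A \<union> B" "y \<in> A \<union> B" "x \<noteq> y" "(x, y) \<notin> H \<inter> (A \<times> A \<union> B \<times> B)"
    consider "x \<in> A" "y \<in> A" | "x \<in> B" "y \<in> B" | "x \<in> A - B" "y \<in> B - A" | "x \<in> B - A" "y \<in> A - B"
      using xy by blast
    then show "\<exists>X Y. separation (A \<union> B) (H \<inter> (A \<times> A \<union> B \<times> B)) X Y \<and>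
      clique (H \<inter> (A \<times> A \<union> B \<times> B)) (X \<inter> Y) \<and> x \<in> X - Y \<and> y \<in> Y - X"
    proof cases
      case 1 then show ?thesis using one_side[OF assms(1) assms(4)] xy by blast
    next
      case 2
      have "clique H (B \<inter> A)" using assms(4) by (simp add: Int_commute)
      then have "\<exists>X Y. separation (B \<union> A) (H \<inter> (B \<times> B \<union> A \<times> A)) X Y \<and>
          clique (H \<inter> (B \<times> B \<union> A \<times> A)) (X \<inter> Y) \<and> x \<in> X - Y \<and> y \<in> Y - X"
        using one_side[OF assms(2), of A x y] xy 2 by blast
      then show ?thesis by (simp only: Un_commute)
    next
      case 3 then show ?thesis using assms(4)
        by (intro exI[of _ A] exI[of _ B]) (auto simp: separation_def clique_def)
    next
      case 4 then show ?thesis using assms(4)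
        by (intro exI[of _ B] exI[of _ A]) (auto simp: separation_def clique_def)
    qed
  qed
qed

text \<open>Avoiding a prescribed clique makes the induction work: \<open>K\<close> lies in one side
  of a clique separation, and the other side has a simplicial vertex off the separator, whose
  neighbours all stay in that side.\<close>

lemma simplicial_vertex_exists:
  assumes "finite V" "chordal V H" "sym H" "clique H K" "K \<subset> V"
  shows "\<exists>v\<in>V - K. clique H {y\<in>V. (v, y) \<in> H}"
  using assms
proof (induction V arbitrary: K rule: finite_psubset_induct)
  case (psubset V)
  show ?case
  proof (cases "clique H V")
    case True
    then show ?thesis using \<open>K \<subset> V\<close> clique_subset[OF True] by (metis (no_types, lifting)
      Diff_iff mem_Collect_eq psubset_imp_ex_mem subsetI)
  next
    case False
    then obtain x y where "x \<in> V" "y \<in> V" "x \<noteq> y" "(x, y) \<notin> H" by (auto simp: clique_def)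
    then obtain X Y where XY: "separation V H X Y" "clique H (X \<inter> Y)" "x \<in> X - Y" "y \<in> Y - X"
      using psubset.prems(1) unfolding chordal_def by meson
    have step: "\<exists>v\<in>V - K. clique H {y\<in>V. (v, y) \<in> H}"
      if S: "separation V H X Y" "clique H (X \<inter> Y)" "x \<in> X - Y" "y \<in> Y - X" "K \<subseteq> Y" for X Y x y
    proof -
      have "X \<subset> V" using S unfolding separation_def by auto
      moreover have "X \<inter> Y \<subset> X" using S by auto
      ultimately obtain v where v: "v \<in> X - X \<inter> Y" "clique H {y\<in>X. (v, y) \<in> H}"
        using psubset.IH[of X "X \<inter> Y"] chordal_subset[OF psubset.prems(1)] S(2) psubset.prems(2)
        by blast
      have "{y\<in>V. (v, y) \<in> H} \<subseteq> {y\<in>X. (v, y) \<in> H}"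
        using v(1) S(1) unfolding separation_def by auto
      then show ?thesis using v S(1,5) clique_subset[OF v(2)] unfolding separation_def
        by (metis (no_types, lifting) Diff_iff Int_iff UnI1 subsetD)
    qed
    have "K \<subseteq> X \<or> K \<subseteq> Y"
      using clique_in_side[OF XY(1) psubset.prems(2,3)] psubset.prems(4) by auto
    then show ?thesis
      using step[OF XY] step[OF separation_sym[OF XY(1) psubset.prems(2)] _ XY(4,3)] XY(2)
      by (auto simp: Int_commute)
  qed
qed

text \<open>Among the vertices of \<open>C\<close> with the most neighbours in \<open>K\<close>, choose one with a clique separation from a
  missed \<open>s \<in> K\<close> whose side \<open>Y\<close> around \<open>s\<close> is least. The first vertex of \<open>C\<close> in \<open>Y\<close> is just as good
  and can be separated off with a smaller side.\<close>

lemma chordal_complete_vertex: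
  assumes fin: "finite V" and ch: "chordal V H" and sH: "sym H"
    and cl: "clique H K" and K: "K \<subseteq> V" and C: "C \<subseteq> V - K" "C \<noteq> {}"
    and conn: "\<And>D. D \<subset> C \<Longrightarrow> D \<noteq> {} \<Longrightarrow> \<exists>x\<in>D. \<exists>y\<in>C - D. (x, y) \<in> H"
    and nb: "\<And>s. s \<in> K \<Longrightarrow> \<exists>c\<in>C. (s, c) \<in> H"
  shows "\<exists>c\<in>C. \<forall>s\<in>K. (c, s) \<in> H"
proof (rule ccontr)
  assume none: "\<not> ?thesis"
  define N where "N c = {s\<in>K. (c, s) \<in> H}" for c
  have finC: "finite C" and finK: "finite K" using fin C K by (auto intro: finite_subset)
  obtain c where c: "c \<in> C" "\<And>d. d \<in> C \<Longrightarrow> card (N d) \<le> card (N c)"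
    using obtains_MAX[OF finC C(2), of "\<lambda>d. card (N d)"] finC
    by (metis Max_ge finite_imageI imageI)
  obtain s where s: "s \<in> K" "(c, s) \<notin> H" using none c(1) by auto
  have max: "N d = N c" if "d \<in> C" "N c \<subseteq> N d" for d
    using card_seteq[of "N d" "N c"] c(2)[OF that(1)] that finK by (auto simp: N_def)
  define Q where "Q X Y \<longleftrightarrow> separation V H X Y \<and> clique H (X \<inter> Y) \<and> s \<in> Y - X \<and>
     (\<exists>d\<in>C. N c \<subseteq> N d \<and> d \<in> X - Y)" for X Y
  have "\<exists>X Y. Q X Y"
  proof -
    have "s \<noteq> c" "s \<in> V" "c \<in> V" using s c C K by auto
    then obtain X Y where "separation V H X Y" "clique H (X \<inter> Y)" "c \<in> X - Y" "s \<in> Y - X"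
      using ch s unfolding chordal_def by metis
    then show ?thesis using c unfolding Q_def by blast
  qed
  then obtain X Y where Q: "Q X Y" and least: "\<And>X' Y'. Q X' Y' \<Longrightarrow> card Y \<le> card Y'"
    using ex_has_least_nat[of "\<lambda>p. Q (fst p) (snd p)" _ "\<lambda>p. card (snd p)"]
    by (metis fst_conv snd_conv)
  then obtain d where XY: "separation V H X Y" "clique H (X \<inter> Y)" "s \<in> Y - X"
      and d: "d \<in> C" "N c \<subseteq> N d" "d \<in> X - Y" unfolding Q_def by auto
  have V: "X \<union> Y = V" using XY unfolding separation_def by auto
  obtain c0 where c0: "c0 \<in> C" "(s, c0) \<in> H" using nb s by auto
  have "c0 \<in> Y" using separation_arc[OF XY(1) sH c0(2)] XY(3) c0 C K s by auto
  then have "C - Y \<subset> C" "C - Y \<noteq> {}" using c0 d by auto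
  then obtain e f where ef: "e \<in> C - Y" "f \<in> C \<inter> Y" "(e, f) \<in> H" using conn[of "C - Y"] by auto
  have fX: "f \<in> X" using separation_arc[OF XY(1) sH ef(3)] ef C by auto
  have KY: "K \<subseteq> Y" using clique_in_side[OF XY(1) sH cl K] XY(3) s by auto
  have NX: "N d \<subseteq> X"
  proof
    fix z assume "z \<in> N d"
    then have "(d, z) \<in> H" "z \<in> V" "d \<in> V" using d C K by (auto simp: N_def)
    then show "z \<in> X" using separation_arc[OF XY(1) sH] d by blast
  qed
  have "N d \<subseteq> N f"
  proof
    fix z assume z: "z \<in> N d"
    then have "z \<in> X \<inter> Y" "z \<in> K" "f \<in> X \<inter> Y" using KY ef fX NX by (auto simp: N_def)
    moreover have "f \<noteq> z" using calculation ef(2) C(1) by auto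
    ultimately show "z \<in> N f" using cliqueD[OF XY(2)] unfolding N_def by blast
  qed
  \<comment> \<open>Since \<open>N c\<close> is largest, \<open>N f\<close> equals it and so misses
    \<open>s\<close> as well.\<close>
  then have f: "N c \<subseteq> N f" "(f, s) \<notin> H" using d max[of f] s ef by (auto simp: N_def)
  have "f \<noteq> s" "f \<in> V" "s \<in> V" using ef s C K by auto
  then obtain X1 Y1 where XY1: "separation V H X1 Y1" "clique H (X1 \<inter> Y1)" "f \<in> X1 - Y1" "s \<in> Y1 - X1"
    using f ch unfolding chordal_def by metis
  \<comment> \<open>The clique \<open>X \<inter> Y\<close> contains \<open>f\<close>, which is not
    in \<open>Y1\<close>. With it inside \<open>X1\<close>, the separator of the new separation
    below lies in \<open>X1 \<inter> Y1\<close>, while \<open>f\<close> leaves the side around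
    \<open>s\<close>.\<close>
  have sub: "X \<inter> Y \<subseteq> X1"
    using clique_in_side[OF XY1(1) sH XY(2)] XY1(3) ef fX V by auto
  have "separation V H (X \<union> X1) (Y \<inter> Y1)"
    using XY(1) XY1(1) unfolding separation_def by auto
  moreover have "clique H ((X \<union> X1) \<inter> (Y \<inter> Y1))"
    using sub by (intro clique_subset[OF XY1(2)]) auto
  ultimately have "Q (X \<union> X1) (Y \<inter> Y1)"
    using d XY(3) XY1(4) unfolding Q_def by auto
  then have "card Y \<le> card (Y \<inter> Y1)" using least by blast
  moreover have "Y \<inter> Y1 \<subset> Y" using XY1(3) ef by auto
  moreover have "finite Y" using fin V by auto
  ultimately show False using psubset_card_mono[of Y "Y \<inter> Y1"] by simp
qed

section \<open>Minimal chordal completions\<close>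

definition component :: "'a rel \<Rightarrow> 'a set \<Rightarrow> 'a \<Rightarrow> 'a set" where
  "component E W x = {y. (x, y) \<in> (E \<inter> W \<times> W)\<^sup>*}"

definition nbhd :: "'a rel \<Rightarrow> 'a set \<Rightarrow> 'a set" where
  "nbhd E C = E `` C - C"

definition linked :: "'a rel \<Rightarrow> 'a set \<Rightarrow> bool" where
  "linked E C \<longleftrightarrow> (\<forall>x\<in>C. \<forall>y\<in>C. (x, y) \<in> (E \<inter> C \<times> C)\<^sup>*)"

lemma component_self: "x \<in> component E W x"
  by (simp add: component_def)

lemma component_subset:
  assumes "x \<in> W"
  shows "component E W x \<subseteq> W"
proof
  fix y assume "y \<in> component E W x"
  then have "(x, y) \<in> (E \<inter> W \<times> W)\<^sup>*" by (simp add: component_def)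
  then show "y \<in> W" using assms by (induction) auto
qed

lemma component_step:
  assumes "x \<in> W" "y \<in> component E W x" "(y, z) \<in> E" "z \<in> W"
  shows "z \<in> component E W x"
  using assms component_subset[OF assms(1), of E] unfolding component_def
  by (auto intro: rtrancl_into_rtrancl)

lemma linked_component:
  assumes "sym E" "x \<in> W"
  shows "linked E (component E W x)"
proof -
  let ?C = "component E W x"
  have from_x: "(x, y) \<in> (E \<inter> ?C \<times> ?C)\<^sup>*" if "y \<in> ?C" for y
  proof -
    have "(x, y) \<in> (E \<inter> W \<times> W)\<^sup>*" using that by (simp add: component_def)
    then show ?thesis
    proof induction
      case (step y z)
      then have "y \<in> ?C" "z \<in> ?C" by (auto simp: component_def intro: rtrancl_into_rtrancl)
      then show ?case using step by (auto intro: rtrancl_into_rtrancl)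
    qed simp
  qed
  have "sym ((E \<inter> ?C \<times> ?C)\<^sup>*)"
    using assms(1) by (intro sym_rtrancl) (auto simp: sym_def)
  then show ?thesis unfolding linked_def by (blast intro: from_x rtrancl_trans dest: symD)
qed

lemma linked_crossing:
  assumes "linked E C" "D \<subset> C" "D \<noteq> {}"
  shows "\<exists>x\<in>D. \<exists>y\<in>C - D. (x, y) \<in> E"
proof (rule ccontr)
  assume none: "\<not> ?thesis"
  obtain x y where xy: "x \<in> D" "y \<in> C" "y \<notin> D" using assms by auto
  then have "(x, y) \<in> (E \<inter> C \<times> C)\<^sup>*" using assms unfolding linked_def by blast
  then have "y \<in> D" by (induction) (use xy none in auto)
  then show False using xy by simp
qed

lemma nbhd_component:
  assumes "x \<in> W"
  shows "nbhd E (component E W x) \<inter> W = {}"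
  using component_step[OF assms] unfolding nbhd_def by fastforce

definition minimal_fill :: "'a set \<Rightarrow> 'a rel \<Rightarrow> 'a rel \<Rightarrow> bool" where
  "minimal_fill V E H \<longleftrightarrow> sym H \<and> H \<subseteq> V \<times> V \<and> E \<subseteq> H \<and> chordal V H \<and>
     (\<forall>H'. sym H' \<longrightarrow> H' \<subseteq> H \<longrightarrow> E \<subseteq> H' \<longrightarrow> chordal V H' \<longrightarrow> H' = H)"

text \<open>A completion inside \<open>H\<close> with the fewest arcs is minimal under
  inclusion.\<close>

lemma minimal_fill_exists:
  assumes "finite V" "sym H" "H \<subseteq> V \<times> V" "E \<subseteq> H" "chordal V H"
  obtains H' where "minimal_fill V E H'" "H' \<subseteq> H"
proof -
  let ?P = "\<lambda>H'. sym H' \<and> H' \<subseteq> H \<and> E \<subseteq> H' \<and> chordal V H'"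
  obtain H' where H': "?P H'" "\<And>H''. ?P H'' \<Longrightarrow> card H' \<le> card H''"
    using ex_has_least_nat[of ?P H card] assms by blast
  have "finite H'" using H'(1) assms by (meson finite_SigmaI finite_subset)
  then have "H'' = H'" if "sym H''" "H'' \<subseteq> H'" "E \<subseteq> H''" "chordal V H''" for H''
    using that H' card_seteq[of H' H''] by (meson subset_trans)
  then have "minimal_fill V E H'" using H'(1) assms(3) unfolding minimal_fill_def by blast
  then show ?thesis using that H'(1) by blast
qed

text \<open>Deleting the fill arcs between \<open>A - B\<close> and \<open>B - A\<close> leaves a
  chordal completion by \<open>chordal_glue\<close>, so by minimality there were none.\<close>

lemma minimal_fill_separation:
  assumes mf: "minimal_fill V E H" and "sym E" and sep: "separation V E A B" and "clique H (A \<inter> B)"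
  shows "separation V H A B"
proof -
  let ?H = "H \<inter> (A \<times> A \<union> B \<times> B)"
  have H: "sym H" "H \<subseteq> V \<times> V" "E \<subseteq> H" "chordal V H" using mf by (auto simp: minimal_fill_def)
  have V: "A \<union> B = V" using sep by (simp add: separation_def)
  have "sym ?H" using H(1) by (auto simp: sym_def)
  moreover have "E \<subseteq> ?H" using separation_arc[OF sep \<open>sym E\<close>] H by fast
  moreover have "chordal V ?H"
    using chordal_glue[of A H B] chordal_subset[OF H(4)] V H(1) assms(4) by blast
  ultimately have "?H = H" using mf unfolding minimal_fill_def by blast
  then show ?thesis using V unfolding separation_def by blast
qed

text \<open>Otherwise splitting \<open>K\<close> into \<open>K - {u}\<close> and \<open>K - {v}\<close> would remove \<open>(u, v)\<close> from the fill.\<close>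

lemma minimal_fill_full_component:
  assumes mf: "minimal_fill V E H" and "sym E"
    and uv: "(u, v) \<in> H" "u \<noteq> v" "(u, v) \<notin> E"
    and K: "clique H K" "K \<subseteq> V" "u \<in> K" "v \<in> K"
  obtains x where "x \<in> V - K" "{u, v} \<subseteq> nbhd E (component E (V - K) x)"
proof (rule ccontr)
  assume "\<not> thesis"
  then have none: "\<not> {u, v} \<subseteq> nbhd E (component E (V - K) x)" if "x \<in> V - K" for x
    using that \<open>\<And>x. \<lbrakk>x \<in> V - K; {u, v} \<subseteq> nbhd E (component E (V - K) x)\<rbrakk> \<Longrightarrow> thesis\<close> by blast
  let ?N = "\<lambda>x. nbhd E (component E (V - K) x)"
  \<comment> \<open>Each component of \<open>V - K\<close> joins the side that holds all its
    neighbours in \<open>K\<close>: a component that sees \<open>v\<close> misses \<open>u\<close>,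
    so it fits into \<open>B\<close>.\<close>
  define A where "A = K - {v} \<union> {x \<in> V - K. v \<notin> ?N x}"
  define B where "B = K - {u} \<union> {x \<in> V - K. v \<in> ?N x}"
  have EV: "E \<subseteq> V \<times> V" using mf by (auto simp: minimal_fill_def)
  have nb: "y \<in> ?N x" if "x \<in> V - K" "(x, y) \<in> E" "y \<in> K" for x y
    using that component_self[of x E] component_subset[of x "V - K" E] unfolding nbhd_def by blast
  have same: "component E (V - K) x = component E (V - K) y"
    if "x \<in> V - K" "y \<in> V - K" "(x, y) \<in> E" for x y
  proof -
    have "(x, y) \<in> E \<inter> (V - K) \<times> (V - K)" "(y, x) \<in> E \<inter> (V - K) \<times> (V - K)"
      using that \<open>sym E\<close> by (auto dest: symD)
    then show ?thesis unfolding component_def by (meson converse_rtrancl_into_rtrancl)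
  qed
  have "separation V E A B"
    unfolding separation_def
  proof (intro conjI ballI)
    show "A \<union> B = V" using K uv unfolding A_def B_def by auto
  next
    fix a b assume ab: "a \<in> A - B" "b \<in> B - A"
    show "(a, b) \<notin> E"
    proof
      assume E: "(a, b) \<in> E"
      then have E': "(b, a) \<in> E" using \<open>sym E\<close> by (auto dest: symD)
      consider "a \<in> K" "b \<in> K" | "a \<in> K" "b \<in> V - K" | "a \<in> V - K" "b \<in> K" | "a \<in> V - K" "b \<in> V - K"
        using E EV by auto
      then show False
      proof cases
        case 1 then show ?thesis using ab E uv unfolding A_def B_def by auto
      next
        case 2 then show ?thesis using ab none[of b] nb[OF _ E'] unfolding A_def B_def by auto
      next
        case 3 then show ?thesis using ab none[of a] nb[OF _ E] unfolding A_def B_def by auto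
      next
        case 4 then show ?thesis using ab same[of a b] E unfolding A_def B_def by auto
      qed
    qed
  qed
  moreover have "clique H (A \<inter> B)"
    using K(1) by (rule clique_subset) (auto simp: A_def B_def)
  ultimately have "separation V H A B" using minimal_fill_separation[OF mf \<open>sym E\<close>] by blast
  moreover have "u \<in> A - B" "v \<in> B - A" using K uv unfolding A_def B_def by auto
  ultimately show False using uv unfolding separation_def by blast
qed

lemma separation_component:
  assumes "sym E" "E \<subseteq> V \<times> V" "K \<subseteq> V" "x \<in> V - K"
  shows "separation V E (component E (V - K) x \<union> nbhd E (component E (V - K) x))
     (V - component E (V - K) x)"
  using component_subset[OF assms(4), of E] assms unfolding separation_def nbhd_def by auto

text \<open>The neighbourhood of the component lies in \<open>K\<close>, so it is a clique that
  separates the component from the rest in \<open>E\<close>, and therefore also in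
  \<open>H\<close>.\<close>

lemma minimal_fill_component_arc:
  assumes mf: "minimal_fill V E H" and "sym E" and K: "clique H K" "K \<subseteq> V" and x: "x \<in> V - K"
    and ab: "a \<in> component E (V - K) x" "(a, b) \<in> H" "b \<notin> component E (V - K) x"
  shows "b \<in> nbhd E (component E (V - K) x)"
proof -
  let ?C = "component E (V - K) x"
  have H: "E \<subseteq> V \<times> V" "H \<subseteq> V \<times> V" using mf by (auto simp: minimal_fill_def)
  have "nbhd E ?C \<subseteq> K" using nbhd_component[OF x, of E] H by (auto simp: nbhd_def)
  then have "clique H ((?C \<union> nbhd E ?C) \<inter> (V - ?C))" by (intro clique_subset[OF K(1)]) auto
  then have "separation V H (?C \<union> nbhd E ?C) (V - ?C)"
    using minimal_fill_separation[OF mf \<open>sym E\<close> separation_component[OF \<open>sym E\<close> H(1) K(2) x]] by blast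
  then show ?thesis using ab H unfolding separation_def by blast
qed

text \<open>\<open>K\<close> is a largest clique containing \<open>u\<close> and \<open>v\<close>,
  and \<open>C\<close> a component of \<open>V - K\<close> that sees both. If \<open>C\<close> saw
  all of \<open>K\<close>, a vertex of \<open>C\<close> complete to \<open>K\<close> would enlarge
  the clique. So some \<open>w\<close> in \<open>K\<close> is not a neighbour of \<open>C\<close>,
  and the component of \<open>w\<close> off \<open>nbhd E C\<close> serves as
  \<open>C'\<close>.\<close>

lemma minimal_fill_separator:
  assumes fin: "finite V" and mf: "minimal_fill V E H" and "sym E"
    and uv: "(u, v) \<in> H" "u \<noteq> v" "(u, v) \<notin> E"
  obtains K C C' where "clique H K" "K \<subseteq> V" "nbhd E C \<subset> K" "linked E C" "linked E C'" "C \<inter> C' = {}"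
    "{u, v} \<subseteq> nbhd E C" "{u, v} \<subseteq> nbhd E C'"
proof -
  have H: "sym H" "H \<subseteq> V \<times> V" "E \<subseteq> H" "chordal V H" "E \<subseteq> V \<times> V"
    using mf by (auto simp: minimal_fill_def)
  let ?P = "\<lambda>K. clique H K \<and> K \<subseteq> V \<and> {u, v} \<subseteq> K"
  have P0: "?P {u, v}" using uv H by (auto simp: clique_def dest: symD)
  have bound: "\<forall>K. ?P K \<longrightarrow> card K < Suc (card V)" using fin by (auto simp: card_mono less_Suc_eq_le)
  obtain K where K: "?P K" and max: "\<And>L. ?P L \<Longrightarrow> card L \<le> card K"
    using ex_has_greatest_nat[of ?P, OF P0 bound] by metis
  have finK: "finite K" using K fin finite_subset by blast
  have maximal: "\<exists>y\<in>K. (x, y) \<notin> H" if "x \<in> V - K" for x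
  proof (rule ccontr)
    assume "\<not> ?thesis"
    then have "?P (insert x K)" using K that clique_insert[of H K x] H(1) by auto
    from max[OF this] show False using that finK by simp
  qed
  obtain x where x: "x \<in> V - K" and full: "{u, v} \<subseteq> nbhd E (component E (V - K) x)"
    using minimal_fill_full_component[OF mf \<open>sym E\<close> uv] K by (metis insert_subset)
  let ?C = "component E (V - K) x"
  let ?S = "nbhd E ?C"
  have C: "?C \<subseteq> V - K" "linked E ?C" "x \<in> ?C"
    using component_subset[OF x] linked_component[OF \<open>sym E\<close> x] component_self by auto
  have SK: "?S \<subseteq> K" using nbhd_component[OF x, of E] H by (auto simp: nbhd_def)
  have "?S \<noteq> K"
  proof
    assume S: "?S = K"
    have "\<exists>c\<in>?C. \<forall>s\<in>K. (c, s) \<in> H"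
    proof (rule chordal_complete_vertex[OF fin H(4,1)])
      show "\<exists>a\<in>D. \<exists>b\<in>?C - D. (a, b) \<in> H" if "D \<subset> ?C" "D \<noteq> {}" for D
        using linked_crossing[OF C(2) that] H(3) by blast
      show "\<exists>c\<in>?C. (s, c) \<in> H" if "s \<in> K" for s
        using that S H(1,3) unfolding nbhd_def by (blast dest: symD)
    qed (use K C in auto)
    then show False using maximal C(1) by blast
  qed
  then obtain w where w: "w \<in> K" "w \<notin> ?S" using SK by auto
  have SV: "?S \<subseteq> V" "clique H ?S" using SK K clique_subset by auto
  have wV: "w \<in> V - ?S" using w K by auto
  let ?D = "component E (V - ?S) w"
  have "y \<in> nbhd E ?D" if "y \<in> {u, v}" for y
  proof (rule minimal_fill_component_arc[OF mf \<open>sym E\<close> SV(2,1) wV component_self])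
    show "(w, y) \<in> H" using K w full that cliqueD[of H K w y] by auto
    show "y \<notin> ?D" using component_subset[OF wV] that full by auto
  qed
  \<comment> \<open>An arc from a common vertex to a vertex of \<open>?D\<close> outside
    \<open>?C\<close> would end in \<open>?S\<close>, which \<open>?D\<close> avoids.\<close>
  moreover have "?C \<inter> ?D = {}"
  proof (rule ccontr)
    assume "?C \<inter> ?D \<noteq> {}"
    moreover have "w \<notin> ?C" using w C by auto
    then have "?D - ?C \<noteq> {}" using component_self by fast
    ultimately obtain a b where "a \<in> ?C \<inter> ?D" "b \<in> ?D - ?C \<inter> ?D" "(a, b) \<in> E"
      using linked_crossing[OF linked_component[OF \<open>sym E\<close> wV], of "?C \<inter> ?D"] by blast
    then show False using component_subset[OF wV, of E] by (auto simp: nbhd_def)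
  qed
  ultimately show ?thesis
    using that[of K ?C ?D] K SK \<open>?S \<noteq> K\<close> C(2) linked_component[OF \<open>sym E\<close> wV] full by blast
qed

section \<open>Odd closed walks and geodesic cycles\<close>

context pair_bidirected_digraph
begin

text \<open>Cutting the loops out of a walk leaves a path with distinct arcs, all taken from the
  walk. Hence walks can replace paths in every upper bound on distances.\<close>

lemma gdist_le_length:
  assumes "awalk u p v"
  shows "gdist G u v \<le> enat (length p)"
proof -
  have ap: "apath u (awalk_to_apath p) v" using assms by (rule apath_awalk_to_apath)
  have "distinct (awalk_to_apath p)" using ap distinct_verts_imp_distinct by (auto simp: apath_def)
  then have "length (awalk_to_apath p) = card (set (awalk_to_apath p))"
    by (simp add: distinct_card)
  also have "\<dots> \<le> card (set p)" using awalk_to_apath_subset[OF assms] by (intro card_mono) auto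
  also have "\<dots> \<le> length p" by (rule card_length)
  finally have "enat (length (awalk_to_apath p)) \<le> enat (length p)" by simp
  then show ?thesis unfolding gdist_def using ap by (auto intro: INF_lower2)
qed

lemma gdist_leE:
  assumes "gdist G u v \<le> enat n"
  obtains p where "awalk u p v" "length p \<le> n"
proof -
  have "gdist G u v < enat (Suc n)" using assms by (metis Suc_ile_eq enat_ord_simps(2) le_less_trans lessI)
  then obtain p where "apath u p v" "length p < Suc n"
    unfolding gdist_def by (auto simp: INF_less_iff)
  then show ?thesis using that[of p] by (auto intro: awalkI_apath)
qed

lemma gdist_triangle: 
  assumes "gdist G u v \<le> enat m" "gdist G v w \<le> enat n"
  shows "gdist G u w \<le> enat (m + n)"
proof -
  obtain p q where "awalk u p v" "length p \<le> m" "awalk v q w" "length q \<le> n"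
    using assms by (meson gdist_leE)
  then have "awalk u (p @ q) w" "enat (length (p @ q)) \<le> enat (m + n)" by (auto intro: awalk_appendI)
  then show ?thesis using gdist_le_length order_trans by blast
qed

lemma closed_walk_gdist_le:
  assumes "awalk u c u" "a \<in> set (awalk_verts u c)" "b \<in> set (awalk_verts u c)"
  shows "gdist G a b \<le> enat (length c)"
proof -
  obtain p q where pq: "c = p @ q" "awalk u p a" "awalk a q u" using awalk_decomp[OF assms(1,2)] by blast
  have rot: "awalk a (q @ p) a" using pq by (auto intro: awalk_appendI)
  have "b \<in> set (awalk_verts a (q @ p))"
    using assms(1,3) pq set_awalk_verts_append[OF pq(3,2)] set_awalk_verts_append[OF pq(2,3)] by auto
  then obtain p' q' where "q @ p = p' @ q'" "awalk a p' b"
    using awalk_decomp[OF rot] by blast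
  moreover from this(1) have "length p' \<le> length c"
    using pq(1) by (metis add.commute le_add1 length_append)
  ultimately show ?thesis using gdist_le_length by (meson enat_ord_simps(1) order_trans)
qed

end

text \<open>A weight on walks modulo 2: it is additive under concatenation and, for symmetric
  \<open>W\<close>, invariant under reversal. When an odd closed walk is split in two along a
  shortcut, one piece is therefore odd.\<close>

definition oddly_in :: "'b set \<Rightarrow> 'b list \<Rightarrow> bool" where
  "oddly_in W p \<longleftrightarrow> odd (length (filter (\<lambda>e. e \<in> W) p))"

lemma oddly_in_simps [simp]:
  "\<not> oddly_in W []"
  "oddly_in W (e # p) \<longleftrightarrow> (e \<in> W) \<noteq> oddly_in W p"
  "oddly_in W (p @ q) \<longleftrightarrow> oddly_in W p \<noteq> oddly_in W q"
  by (auto simp: oddly_in_def)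

lemma oddly_in_rev_path: "sym W \<Longrightarrow> oddly_in W (rev_path p) = oddly_in W p"
proof (induction p)
  case (Cons e p)
  then have "(snd e, fst e) \<in> W \<longleftrightarrow> e \<in> W" by (metis prod.collapse symD)
  with Cons show ?case by auto
qed simp

lemma oddly_in_disjoint: "set p \<inter> W = {} \<Longrightarrow> \<not> oddly_in W p"
  by (induction p) auto

lemma oddly_in_cong: "(\<And>e. e \<in> set p \<Longrightarrow> e \<in> W \<longleftrightarrow> e \<in> W') \<Longrightarrow> oddly_in W p = oddly_in W' p"
  by (induction p) auto

lemma length_rev_path [simp]: "length (rev_path p) = length p"
  by (induction p) auto

context pair_bidirected_digraph
begin

text \<open>Each counted arc toggles membership in \<open>C\<close>; in particular closed walks
  cross the boundary of \<open>C\<close> evenly often.\<close>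

lemma oddly_in_boundary:
  assumes "awalk u p v"
  shows "oddly_in {(x, y). (x \<in> C) \<noteq> (y \<in> C)} p \<longleftrightarrow> (u \<in> C) \<noteq> (v \<in> C)"
  using assms by (induction p arbitrary: u) (auto simp: awalk_simps)

lemma closed_walk_ends: 
  assumes "awalk u p u"
  shows "snd ` set p = fst ` set p"
proof (cases "p = []")
  case False
  have c: "cas u p u" using assms by auto
  \<comment> \<open>Both sides list the vertices of the walk.\<close>
  have "map fst p @ [snd (last p)] = u # map snd p"
    using awalk_verts_conv[of u p] awalk_verts_conv'[OF c] False c
    by (simp add: cas_simp)
  then have "insert u (fst ` set p) = insert u (snd ` set p)"
    using False c awalk_verts_conv[of u p] awlast_if_cas[OF c]
    by (metis list.set_map list.simps(15) last_snoc set_append Un_insert_right list.set(1) sup_bot_right)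
  moreover have "u \<in> fst ` set p" using False c by (cases p) auto
  moreover have "u \<in> snd ` set p"
    using False awalk_verts_conv[of u p] awlast_if_cas[OF c] by (metis imageI last_in_set last_snoc)
  ultimately show ?thesis by (simp add: insert_absorb)
qed simp

text \<open>If two vertices of the walk could be joined by a path shorter than both parts of the walk
  between them, that path would split it into two shorter closed walks, one of them odd.\<close>

lemma shortest_odd_walk_shortcut:
  assumes W: "sym W"
    and odd: "oddly_in W (p @ q @ r)"
    and min: "\<forall>u c. awalk u c u \<longrightarrow> oddly_in W c \<longrightarrow> length (p @ q @ r) \<le> length c"
    and walks: "awalk u p x" "awalk x q y" "awalk y r u" "awalk x s y"
  shows "length q \<le> length s \<or> length p + length r \<le> length s"
proof (rule ccontr)
  assume short: "\<not> ?thesis"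
  have "awalk u (p @ s @ r) u" "awalk x (q @ rev_path s) x"
    using walks by (auto intro!: awalk_appendI)
  \<comment> \<open>Modulo 2 the two contributions of \<open>s\<close> cancel, so the parities of
    the two walks add up to that of the original walk.\<close>
  moreover have "oddly_in W (p @ s @ r) \<or> oddly_in W (q @ rev_path s)"
    using odd oddly_in_rev_path[OF W, of s] by auto
  ultimately show False using min[rule_format, of u "p @ s @ r"] min[rule_format, of x "q @ rev_path s"] short by auto
qed

text \<open>A shortest odd closed walk works. By \<open>shortest_odd_walk_shortcut\<close> it
  repeats no vertex, and any walk in \<open>G\<close> between two of its vertices is at least as
  long as one of the two ways around.\<close>

lemma odd_closed_walk_geodesic_cycle:
  assumes W: "sym W" and p0: "awalk u0 p0 u0" "oddly_in W p0"
  obtains c where "geodesic_cycle G c" "oddly_in W c"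
proof -
  let ?P = "\<lambda>(u, c). awalk u c u \<and> oddly_in W c"
  have "?P (u0, p0)" using p0 by simp
  from ex_has_least_nat[of ?P, OF this, of "\<lambda>(u, c). length c"]
  obtain u c where c: "awalk u c u" "oddly_in W c"
    and min: "\<forall>v d. awalk v d v \<longrightarrow> oddly_in W d \<longrightarrow> length c \<le> length d" by auto
  note shortcut = shortest_odd_walk_shortcut[OF W]
  \<comment> \<open>At a repeated vertex the empty walk would be a shortcut.\<close>
  have dist: "distinct (map snd c)"
  proof (rule ccontr)
    assume "\<not> ?thesis"
    then obtain xs ys zs x where "map snd c = xs @ [x] @ ys @ [x] @ zs"
      using not_distinct_decomp by blast
    then obtain p e q f r where c_eq: "c = (p @ [e]) @ (q @ [f]) @ r" "snd e = x" "snd f = x"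
      by (auto simp: map_eq_append_conv map_eq_Cons_conv Cons_eq_map_conv append_eq_map_conv)
    have walks: "awalk u (p @ [e]) x" "awalk x (q @ [f]) x" "awalk x r u" 
      using c(1) c_eq by (auto simp: awalk_simps)
    then have "awalk x [] x" by (auto simp: awalk_simps)
    from shortcut[OF c(2)[unfolded c_eq(1)] min[unfolded c_eq(1)] walks this] show False by simp
  qed
  \<comment> \<open>A single arc would be a loop, and two arcs would traverse one edge back and
    forth, which counts evenly.\<close>
  have len: "3 \<le> length c"
  proof (rule ccontr)
    assume "\<not> ?thesis"
    moreover have "c \<noteq> []" using c(2) by auto
    ultimately consider e where "c = [e]" | e f where "c = [e, f]"
      by (cases c; cases "tl c"; cases "tl (tl c)") auto
    then show False
    proof cases
      case 1 then show ?thesis using c(1) pair_no_loops[of e] by (auto simp: awalk_simps)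
    next
      case 2
      then have "f = (snd e, fst e)" using c(1) by (auto simp: awalk_simps prod_eq_iff)
      then have "f \<in> W \<longleftrightarrow> e \<in> W" using W by (metis prod.collapse symD)
      then show ?thesis using c(2) 2 by auto
    qed
  qed
  have "cas u c u" using c(1) by auto
  then have "tl (awalk_verts u c) = map snd c" using awalk_verts_conv' len by auto
  then have cyc: "ucycle G c" using dist c(1) len unfolding ucycle_def cycle_def by auto
  let ?H = "cycle_subgraph c"
  have Hs: "pverts ?H = fst ` set c" "parcs ?H = set c \<union> (set c)\<inverse>" by (auto simp: cycle_subgraph_def)
  have cG: "set c \<subseteq> parcs G" using c(1) by auto
  have HG: "parcs ?H \<subseteq> parcs G" "pverts ?H \<subseteq> pverts G"
    using cG arcs_symmetric in_arcsD1 by (auto simp: Hs)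
  have bid: "pair_bidirected_digraph ?H"
  proof
    fix e assume "e \<in> parcs ?H"
    then have "fst e \<in> fst ` set c \<union> snd ` set c \<and> snd e \<in> fst ` set c \<union> snd ` set c"
      unfolding Hs by (cases e) (auto simp: rev_image_eqI)
    then show "fst e \<in> pverts ?H" "snd e \<in> pverts ?H"
      using closed_walk_ends[OF c(1)] unfolding Hs by auto
  next
    show "symmetric (with_proj ?H)"
      unfolding symmetric_def with_proj_simps Hs by (auto simp: sym_def)
    show "fst e \<noteq> snd e" if "e \<in> parcs ?H" for e using that HG pair_no_loops by auto
  qed
  then interpret H: pair_bidirected_digraph ?H .
  have walkH: "H.awalk x p y" if "awalk x p y" "set p \<subseteq> set c" "x \<in> fst ` set c" for x p y
    using that unfolding H.awalk_def by (auto simp: Hs)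
  \<comment> \<open>The two candidates for \<open>t\<close> are the segment \<open>q\<close> and the
    complementary segment \<open>r @ p\<close> run backwards.\<close>
  have one_order: "\<exists>t. H.awalk x t y \<and> length t \<le> length s"
    if c_eq: "c = p @ q @ r" and walks: "awalk u p x" "awalk x q y" "awalk y r u" 
      and s: "awalk x s y" and ends: "x \<in> fst ` set c" "y \<in> fst ` set c" for x y p q r s
  proof -
    have "H.awalk x q y" using walkH[OF walks(2)] ends c_eq by auto
    moreover have "awalk y (r @ p) x" using walks by (auto intro: awalk_appendI)
    then have "H.awalk y (r @ p) x" using walkH[of y "r @ p" x] ends c_eq by (auto simp del: awalk_append_iff)
    then have "H.awalk x (rev_path (r @ p)) y" by (metis H.awalk_rev_path)
    moreover have "length q \<le> length s \<or> length p + length r \<le> length s"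
      using shortcut[OF c(2)[unfolded c_eq] min[unfolded c_eq] walks s] .
    ultimately show ?thesis by (metis add.commute length_append length_rev_path)
  qed
  have shortest: "\<exists>t. H.awalk x t y \<and> length t \<le> length s"
    if s: "awalk x s y" and ends: "x \<in> fst ` set c" "y \<in> fst ` set c" for x y s
  proof -
    obtain e f where e: "e \<in> set c" "fst e = x" and f: "f \<in> set c" "fst f = y" using ends by auto
    obtain a b where ab: "c = a @ e # b" using e(1) by (meson split_list)
    have wab: "awalk u a x" "awalk x (e # b) u" using c(1) e(2) unfolding ab by (auto simp: awalk_simps)
    consider "f \<in> set (e # b)" | "f \<in> set a" using f ab by auto
    then show ?thesis
    proof cases
      case 1
      then obtain a' b' where ab': "e # b = a' @ f # b'" by (meson split_list)
      have "awalk x a' y" "awalk y (f # b') u" 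
        using wab(2) f(2) unfolding ab' by (auto simp: awalk_simps)
      then show ?thesis using one_order[of a a' "f # b'" x y s] ab ab' wab(1) s ends by simp
    next
      \<comment> \<open>Here \<open>y\<close> precedes \<open>x\<close> on \<open>c\<close>, so
        their roles are exchanged and \<open>s\<close> is reversed.\<close>
      case 2
      then obtain a' b' where ab': "a = a' @ f # b'" by (meson split_list)
      have "awalk u a' y" "awalk y (f # b') x"
        using wab(1) f(2) unfolding ab' by (auto simp: awalk_simps)
      then obtain t where "H.awalk y t x" "length t \<le> length (rev_path s)"
        using one_order[of a' "f # b'" "e # b" y x "rev_path s"] ab ab' wab(2) s ends by auto
      then show ?thesis by (metis H.awalk_rev_path length_rev_path)
    qed
  qed
  have "gdist ?H x y = gdist G x y" if xy: "x \<in> pverts ?H" "y \<in> pverts ?H" for x y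
  proof (rule antisym)
    show "gdist ?H x y \<le> gdist G x y"
      unfolding gdist_def[of G]
    proof (rule INF_greatest)
      fix s assume "s \<in> {p. apath x p y}"
      then have "awalk x s y" by (auto intro: awalkI_apath)
      then obtain t where "H.awalk x t y" "length t \<le> length s"
        using shortest xy by (metis Hs(1))
      then show "gdist ?H x y \<le> enat (length s)"
        using H.gdist_le_length by (meson enat_ord_simps(1) order_trans)
    qed
    show "gdist G x y \<le> gdist ?H x y"
      unfolding gdist_def[of ?H]
    proof (rule INF_greatest)
      fix s assume "s \<in> {p. H.apath x p y}"
      then have "H.awalk x s y" by (auto intro: H.awalkI_apath)
      then have "awalk x s y" using HG unfolding awalk_def H.awalk_def by auto
      then show "gdist G x y \<le> enat (length s)" by (rule gdist_le_length)
    qed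
  qed
  moreover have "subgraph (with_proj ?H) (with_proj G)"
    unfolding subgraph_def compatible_def using HG wf_digraph_axioms H.wf_digraph_axioms by simp
  ultimately have "geodesic_cycle G c" using cyc bid unfolding geodesic_cycle_def geodesic_def by blast
  then show ?thesis using that c(2) by blast
qed

lemma linked_awalk:
  assumes "linked (parcs G) C" "x \<in> C" "y \<in> C" "x \<in> pverts G"
  obtains q where "awalk x q y" "set q \<subseteq> C \<times> C"
proof -
  have "(x, y) \<in> (parcs G \<inter> C \<times> C)\<^sup>*" using assms unfolding linked_def by blast
  then have "\<exists>q. awalk x q y \<and> set q \<subseteq> C \<times> C"
  proof induction
    case base then show ?case using assms(4) by (intro exI[of _ "[]"]) (auto simp: awalk_simps)
  next
    case (step y z)
    then obtain q where "awalk x q y" "set q \<subseteq> C \<times> C" by blast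
    moreover have "awalk y [(y, z)] z" using step in_arcsD2 by (auto simp: awalk_simps)
    ultimately show ?case using step by (intro exI[of _ "q @ [(y, z)]"]) (auto intro!: awalk_appendI)
  qed
  then show ?thesis using that by blast
qed

lemma nbhd_sides_close:
  assumes C: "linked (parcs G) C" "linked (parcs G) C'" "C \<inter> C' = {}"
    and AB: "nbhd (parcs G) C = A \<union> B" "A \<inter> B = {}" "u \<in> A" "v \<in> B" "{u, v} \<subseteq> nbhd (parcs G) C'"
    and geo: "\<And>c. geodesic_cycle G c \<Longrightarrow> length c \<le> l"
  shows "\<exists>a\<in>A. \<exists>b\<in>B. gdist G a b \<le> enat l"
proof -
  \<comment> \<open>\<open>W\<close> is the part of the boundary of \<open>C\<close> that leads to
    \<open>A\<close>; the arcs between \<open>C\<close> and \<open>B\<close> make up the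
    rest.\<close>
  define W where "W = C \<times> A \<union> A \<times> C"
  have W: "sym W" by (auto simp: W_def sym_def)
  have AC: "A \<inter> C = {}" "B \<inter> C = {}" using AB(1) by (auto simp: nbhd_def)
  have "u \<in> nbhd (parcs G) C" "v \<in> nbhd (parcs G) C" using AB by auto
  then obtain c1 c2 d1 d2 where ends: "c1 \<in> C" "c2 \<in> C" "d1 \<in> C'" "d2 \<in> C'"
    "(c1, u) \<in> parcs G" "(c2, v) \<in> parcs G" "(d1, v) \<in> parcs G" "(d2, u) \<in> parcs G"
    using AB(5) unfolding nbhd_def by auto
  obtain q where q: "awalk c1 q c2" "set q \<subseteq> C \<times> C"
    using linked_awalk[OF C(1)] ends in_arcsD1 by metis
  obtain r where r: "awalk d1 r d2" "set r \<subseteq> C' \<times> C'"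
    using linked_awalk[OF C(2)] ends in_arcsD1 by metis
  \<comment> \<open>From \<open>u\<close> through \<open>C\<close> to \<open>v\<close> and back
    through \<open>C'\<close>: only the first arc belongs to \<open>W\<close>.\<close>
  let ?p = "(u, c1) # q @ (c2, v) # (v, d1) # r @ [(d2, u)]"
  have "awalk d2 [(d2, u)] u" using ends in_arcsD2 by (auto simp: awalk_simps)
  then have "awalk d1 (r @ [(d2, u)]) u" using r by (auto intro: awalk_appendI)
  then have "awalk c2 ((c2, v) # (v, d1) # r @ [(d2, u)]) u"
    using ends arcs_symmetric by (auto simp: awalk_Cons_iff)
  then have "awalk c1 (q @ (c2, v) # (v, d1) # r @ [(d2, u)]) u" using q(1) awalk_appendI by blast
  then have "awalk u ?p u" using ends arcs_symmetric by (auto simp: awalk_Cons_iff)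
  moreover have "oddly_in W ?p"
  proof -
    have "\<not> oddly_in W q" using q(2) AC by (intro oddly_in_disjoint) (auto simp: W_def)
    moreover have "\<not> oddly_in W r" using r(2) C(3) by (intro oddly_in_disjoint) (auto simp: W_def)
    moreover have "(u, c1) \<in> W" "(c2, v) \<notin> W" "(v, d1) \<notin> W" "(d2, u) \<notin> W"
      using ends AC AB C(3) by (auto simp: W_def)
    ultimately show ?thesis by simp
  qed
  ultimately obtain c where c: "geodesic_cycle G c" "oddly_in W c"
    using odd_closed_walk_geodesic_cycle[OF W] by blast
  then obtain w where w: "awalk w c w" by (auto simp: geodesic_cycle_def ucycle_def cycle_def)
  have on_c: "x \<in> set (awalk_verts w c)" "y \<in> set (awalk_verts w c)" if "(x, y) \<in> set c" for x y
    using awalk_verts_arc1[of "(x, y)" c w] awalk_verts_arc2[of w c w "(x, y)"] w that by auto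
  obtain a where a: "a \<in> A" "a \<in> set (awalk_verts w c)"
    using oddly_in_disjoint[of c W] c(2) on_c unfolding W_def by blast
  have "\<exists>b\<in>B. b \<in> set (awalk_verts w c)"
  proof (rule ccontr)
    assume none: "\<not> ?thesis"
    \<comment> \<open>On a walk that avoids \<open>B\<close>, the arcs in \<open>W\<close> are
      exactly those crossing the boundary of \<open>C\<close>, and their number is even.\<close>
    have "oddly_in W c = oddly_in {(x, y). (x \<in> C) \<noteq> (y \<in> C)} c"
    proof (rule oddly_in_cong, clarify)
      fix x y assume xy: "(x, y) \<in> set c"
      then have "(x, y) \<in> parcs G" "(y, x) \<in> parcs G" using w arcs_symmetric by blast+
      then have "x \<in> C \<Longrightarrow> y \<notin> C \<Longrightarrow> y \<in> A \<union> B" "y \<in> C \<Longrightarrow> x \<notin> C \<Longrightarrow> x \<in> A \<union> B"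
        using AB(1) unfolding nbhd_def by auto
      then show "(x, y) \<in> W \<longleftrightarrow> (x, y) \<in> {(x, y). (x \<in> C) \<noteq> (y \<in> C)}"
        using on_c[OF xy] none AC by (auto simp: W_def)
    qed
    then show False using oddly_in_boundary[OF w] c(2) by simp
  qed
  then obtain b where b: "b \<in> B" "b \<in> set (awalk_verts w c)" by blast
  have "gdist G a b \<le> enat (length c)" using closed_walk_gdist_le[OF w a(2) b(2)] .
  then show ?thesis using a b geo[OF c(1)] by (meson enat_ord_simps(1) order_trans)
qed

text \<open>\<open>R j\<close> collects the vertices of \<open>S\<close> within distance
  \<open>l * j\<close> of \<open>u\<close>. While \<open>v\<close> is missing, \<open>close\<close>
  applied to \<open>R j\<close> and \<open>S - R j\<close> adds a vertex at the next step. As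
  \<open>R 0\<close> already contains \<open>u\<close>, all of \<open>S\<close> is exhausted after
  \<open>card S - 1\<close> steps.\<close>

lemma gdist_le_of_sides_close:
  assumes "finite S" "u \<in> S" "v \<in> S" "u \<in> pverts G"
    and close: "\<And>A B. A \<union> B = S \<Longrightarrow> A \<inter> B = {} \<Longrightarrow> u \<in> A \<Longrightarrow> v \<in> B \<Longrightarrow>
      \<exists>a\<in>A. \<exists>b\<in>B. gdist G a b \<le> enat l"
  shows "gdist G u v \<le> enat (l * (card S - 1))"
proof -
  define R where "R j = {s\<in>S. gdist G u s \<le> enat (l * j)}" for j
  have finR: "finite (R j)" for j using assms(1) by (simp add: R_def)
  have "gdist G u u \<le> enat (length ([] :: ('a \<times> 'a) list))"
    by (rule gdist_le_length[of u "[]" u]) (simp add: awalk_Nil_iff assms(4))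
  then have "gdist G u u \<le> enat n" for n by (rule order_trans) simp
  then have u: "u \<in> R j" for j using assms(2) by (simp add: R_def)
  have "v \<in> R j \<or> j < card (R j)" for j
  proof (induction j)
    case 0
    have "R 0 \<noteq> {}" using u by blast
    then show ?case using finR by (simp add: card_gt_0_iff)
  next
    case (Suc j)
    have mono: "R j \<subseteq> R (Suc j)"
      unfolding R_def using order_trans[of _ "enat (l * j)" "enat (l * Suc j)"] by auto
    show ?case
    proof (cases "v \<in> R j")
      case False
      then obtain a b where ab: "a \<in> R j" "b \<in> S - R j" "gdist G a b \<le> enat l"
        using close[of "R j" "S - R j"] u assms(3) by (auto simp: R_def)
      then have "b \<in> R (Suc j)" using gdist_triangle[of u a "l * j" b l]
        by (auto simp: R_def add.commute)
      then have "R j \<subset> R (Suc j)" using ab mono by auto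
      then have "card (R j) < card (R (Suc j))" using finR psubset_card_mono by blast
      then show ?thesis using Suc False by simp
    qed (use mono in auto)
  qed
  from this[of "card S - 1"] show ?thesis
  proof
    assume "card S - 1 < card (R (card S - 1))"
    then have "R (card S - 1) = S" using assms(1) by (intro card_seteq) (auto simp: R_def)
    then show ?thesis using assms(3) by (auto simp: R_def)
  qed (auto simp: R_def)
qed

end

section \<open>Chordal completion from a tree-decomposition\<close>

lemma (in pair_bidirected_digraph) awalk_crossing:
  assumes "awalk a p b" "a \<in> B" "b \<notin> B"
  obtains y z where "(y, z) \<in> set p" "y \<in> B" "z \<notin> B"
proof -
  have "\<exists>y z. (y, z) \<in> set p \<and> y \<in> B \<and> z \<notin> B"
    using assms
  proof (induction p arbitrary: a)
    case (Cons e p)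
    then have e: "e = (a, snd e)" "awalk (snd e) p b" by (auto simp: awalk_simps)
    show ?case
    proof (cases "snd e \<in> B")
      case True then show ?thesis using Cons e by (meson list.set_intros(2))
    next
      case False then show ?thesis using Cons.prems e by (metis list.set_intros(1))
    qed
  qed (auto simp: awalk_simps)
  then show ?thesis using that by blast
qed

lemma (in pair_bidirected_digraph) awalk_in_component:
  assumes "awalk t p x" "s \<notin> set (awalk_verts t p)"
  shows "x \<in> component (parcs G) (pverts G - {s}) t"
  using assms
proof (induction p arbitrary: t)
  case Nil then show ?case by (auto simp: awalk_simps component_self)
next
  case (Cons e p)
  then have "(t, snd e) \<in> parcs G" "t \<noteq> s" "snd e \<noteq> s"
    by (auto simp: awalk_simps hd_in_awalk_verts(1))
  then have "(t, snd e) \<in> parcs G \<inter> (pverts G - {s}) \<times> (pverts G - {s})"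
    using in_arcsD1 in_arcsD2 by auto
  moreover have "x \<in> component (parcs G) (pverts G - {s}) (snd e)"
    using Cons by (auto simp: awalk_simps)
  ultimately show ?case unfolding component_def by (auto intro: converse_rtrancl_into_rtrancl)
qed

lemma utree_bidirected: "utree T \<Longrightarrow> pair_bidirected_digraph T"
  by (simp add: utree_def uforest_def)

lemma utree_apath_exists:
  assumes "utree T" "s \<in> pverts T" "t \<in> pverts T"
  obtains p where "pre_digraph.apath (with_proj T) s p t"
proof -
  interpret pair_bidirected_digraph T using assms(1) by (rule utree_bidirected)
  have "strongly_connected (with_proj T)"
    using assms(1) sym_arcs by (intro symmetric_connected_imp_strongly_connected) (auto simp: utree_def)
  then have "s \<rightarrow>\<^sup>*\<^bsub>with_proj T\<^esub> t" using assms by auto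
  then show ?thesis using that reachable_apath by blast
qed

text \<open>An arc leaving the branch can only lead to \<open>s\<close>. If it started at
  \<open>y\<close> other than \<open>t\<close>, a path from \<open>t\<close> to \<open>y\<close>
  inside the branch would close up to a cycle through \<open>s\<close>.\<close>

lemma utree_arc_cut:
  assumes T: "utree T" and st: "(s, t) \<in> parcs T"
    and yz: "y \<in> component (parcs T) (pverts T - {s}) t" "(y, z) \<in> parcs T"
      "z \<notin> component (parcs T) (pverts T - {s}) t"
  shows "y = t \<and> z = s"
proof -
  interpret pair_bidirected_digraph T using T by (rule utree_bidirected)
  let ?B = "component (parcs T) (pverts T - {s}) t"
  have tW: "t \<in> pverts T - {s}" using st in_arcsD2 no_loops' by auto
  have z: "z = s" using component_step[OF tW yz(1,2)] yz(2,3) in_arcsD2 by blast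
  have BW: "?B \<subseteq> pverts T - {s}" using component_subset[OF tW] .
  have "sym (parcs T)" using arcs_symmetric by (auto simp: sym_def)
  then have "linked (parcs T) ?B" using linked_component[OF _ tW] by blast
  then obtain q where q: "awalk t q y" "set q \<subseteq> ?B \<times> ?B"
    using linked_awalk[of ?B t y] yz(1) tW component_self by (metis DiffD1)
  define p where "p = awalk_to_apath q"
  have p: "apath t p y" "set p \<subseteq> ?B \<times> ?B"
    using apath_awalk_to_apath[OF q(1)] awalk_to_apath_subset[OF q(1)] q(2) by (auto simp: p_def)
  have walk: "awalk t p y" using p(1) by (rule awalkI_apath)
  have "set (awalk_verts t p) \<subseteq> ?B"
    using set_awalk_verts[OF walk] p(2) component_self[of t] by auto
  then have sp: "s \<notin> set (awalk_verts t p)" using BW by auto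
  have "y = t"
  proof (rule ccontr)
    assume "y \<noteq> t"
    then have ne: "p \<noteq> []" using walk by (auto simp: awalk_simps)
    let ?c = "(s, t) # p @ [(y, s)]"
    have ys: "awalk y [(y, s)] s" using yz z in_arcsD2 by (auto simp: awalk_simps)
    then have tail: "awalk t (p @ [(y, s)]) s" using walk by (rule awalk_appendI[rotated])
    then have c: "awalk s ?c s" using st by (auto simp: awalk_Cons_iff simp del: awalk_append_iff)
    have "awalk_verts t (p @ [(y, s)]) = awalk_verts t p @ [s]"
      using awalk_verts_append[OF tail] by simp
    then have "distinct (tl (awalk_verts s ?c))" using p(1) sp by (simp add: apath_def)
    \<comment> \<open>As \<open>p\<close> is nonempty, the closed walk has the three arcs that
      \<open>ucycle\<close> demands.\<close>
    then have "ucycle T ?c" using c ne unfolding ucycle_def cycle_def by (cases p) auto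
    then show False using T by (auto simp: utree_def uforest_def)
  qed
  then show ?thesis using z by simp
qed

text \<open>The tree path from \<open>a\<close> to \<open>b\<close> has to leave the branch along
  the arc between \<open>t\<close> and \<open>s\<close>, so both nodes lie on it and (T3) applies to
  each.\<close>

lemma td_arc_cut:
  assumes td: "tree_decomposition G T P" and st: "(s, t) \<in> parcs T"
    and ab: "a \<in> component (parcs T) (pverts T - {s}) t"
      "b \<in> pverts T" "b \<notin> component (parcs T) (pverts T - {s}) t"
  shows "P a \<inter> P b \<subseteq> P s \<inter> P t"
proof -
  have T: "utree T" using td by (simp add: tree_decomposition_def)
  interpret pair_bidirected_digraph T using T by (rule utree_bidirected)
  have "t \<in> pverts T - {s}" using st in_arcsD2 no_loops' by auto
  then have "a \<in> pverts T" using ab(1) component_subset by (metis DiffD1 subsetD)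
  then obtain p where p: "apath a p b" using utree_apath_exists[OF T _ ab(2)] by blast
  then have walk: "awalk a p b" by (rule awalkI_apath)
  obtain y z where yz: "(y, z) \<in> set p" "y \<in> component (parcs T) (pverts T - {s}) t"
    "z \<notin> component (parcs T) (pverts T - {s}) t"
    using awalk_crossing[OF walk ab(1,3)] .
  have "(y, z) \<in> parcs T" using walk yz(1) by auto
  then have "y = t" "z = s" using utree_arc_cut[OF T st yz(2) _ yz(3)] by auto
  then have "s \<in> set (awalk_verts a p)" "t \<in> set (awalk_verts a p)"
    using awalk_verts_arc1[OF yz(1)] awalk_verts_arc2[OF walk yz(1)] by auto
  then show ?thesis using td p unfolding tree_decomposition_def by blast
qed

definition td_fill :: "'t pair_pre_digraph \<Rightarrow> ('t \<Rightarrow> 'a set) \<Rightarrow> 'a rel" where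
  "td_fill T P = {(x, y). x \<noteq> y \<and> (\<exists>t\<in>pverts T. x \<in> P t \<and> y \<in> P t)}"

lemma sym_td_fill: "sym (td_fill T P)"
  by (auto simp: td_fill_def sym_def)

text \<open>On a tree path from a part with \<open>x\<close> to a part with \<open>y\<close> there
  is an arc \<open>(s, t)\<close> at which \<open>x\<close> drops out. The unions of the parts on
  its two sides form the separation; they meet inside \<open>P s\<close>, which is a clique of the
  fill.\<close>

lemma chordal_td_fill:
  assumes td: "tree_decomposition G T P"
  shows "chordal (pverts G) (td_fill T P)"
  unfolding chordal_def
proof (intro ballI impI)
  fix x y assume xy: "x \<in> pverts G" "y \<in> pverts G" "x \<noteq> y" "(x, y) \<notin> td_fill T P"
  have T: "utree T" and V: "pverts G = (\<Union>t \<in> pverts T. P t)"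
    using td by (simp_all add: tree_decomposition_def)
  interpret pair_bidirected_digraph T using T by (rule utree_bidirected)
  obtain tx ty where t: "tx \<in> pverts T" "x \<in> P tx" "ty \<in> pverts T" "y \<in> P ty" using xy V by auto
  have apart: "\<not> (x \<in> P t \<and> y \<in> P t)" if "t \<in> pverts T" for t
    using xy(3,4) that by (auto simp: td_fill_def)
  obtain p where p: "apath tx p ty" using utree_apath_exists[OF T t(1,3)] .
  obtain s t where st: "(s, t) \<in> set p" "x \<in> P s" "x \<notin> P t"
    using awalk_crossing[of tx p ty "{s. x \<in> P s}"] awalkI_apath[OF p] t apart by blast
  obtain p1 p2 where p_eq: "p = p1 @ (s, t) # p2" using split_list[OF st(1)] by blast
  have p2: "awalk t p2 ty" "s \<notin> set (awalk_verts t p2)" and arc: "(s, t) \<in> parcs T"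
    using p unfolding p_eq apath_append_iff apath_Cons_iff by (auto simp: apath_def)
  let ?B = "component (parcs T) (pverts T - {s}) t"
  have tW: "t \<in> pverts T - {s}" using arc in_arcsD2 no_loops' by auto
  have B: "?B \<subseteq> pverts T - {s}" "ty \<in> ?B" using component_subset[OF tW] awalk_in_component[OF p2] by auto
  have s: "s \<in> pverts T" using arc in_arcsD1 by auto
  note cut = td_arc_cut[OF td arc]
  let ?X = "\<Union>b\<in>pverts T - ?B. P b" and ?Y = "\<Union>b\<in>?B. P b"
  have XY: "?X \<inter> ?Y \<subseteq> P s \<inter> P t" using cut by fastforce
  have "?X \<union> ?Y = pverts G" using V B(1) by auto
  moreover have "(a, b) \<notin> td_fill T P" if "a \<in> ?X - ?Y" "b \<in> ?Y - ?X" for a b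
    using that by (auto simp: td_fill_def)
  ultimately have "separation (pverts G) (td_fill T P) ?X ?Y"
    unfolding separation_def by blast
  moreover have "clique (td_fill T P) (?X \<inter> ?Y)"
    using XY s unfolding clique_def td_fill_def by blast
  \<comment> \<open>If \<open>x\<close> were in both sides it would lie in \<open>P t\<close>; if
    \<open>y\<close> were, it would lie in \<open>P s\<close> together with
    \<open>x\<close>.\<close>
  moreover have "x \<in> ?X - ?Y" using st s B XY by blast
  moreover have "y \<in> ?Y - ?X" using B t apart[OF s] st(2) XY by blast
  ultimately show "\<exists>X Y. separation (pverts G) (td_fill T P) X Y \<and>
      clique (td_fill T P) (X \<inter> Y) \<and> x \<in> X - Y \<and> y \<in> Y - X" by blast
qed

text \<open>A Helly argument: \<open>K\<close> is carried along the path towards a part with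
  \<open>w\<close>. While \<open>w\<close> is not in \<open>P t\<close>, each \<open>u\<close> in
  \<open>K\<close> shares with \<open>w\<close> a part beyond the next arc, so \<open>u\<close> also
  lies in the next part on the path.\<close>

lemma td_extend_clique:
  assumes td: "tree_decomposition G T P"
    and p: "pre_digraph.apath (with_proj T) t p s" and w: "w \<in> P s" and K: "K \<subseteq> P t"
    and cl: "clique (td_fill T P) (insert w K)"
  shows "\<exists>t'\<in>pverts T. insert w K \<subseteq> P t'"
proof -
  have T: "utree T" using td by (simp add: tree_decomposition_def)
  interpret pair_bidirected_digraph T using T by (rule utree_bidirected)
  show ?thesis using p K
  proof (induction p arbitrary: t)
    case Nil then show ?case using w by (auto simp: apath_simps)
  next
    case (Cons e p)
    define t' where "t' = snd e"
    have e: "(t, t') \<in> parcs T" "apath t' p s" "t \<notin> set (awalk_verts t' p)"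
      using Cons.prems(1) unfolding t'_def apath_Cons_iff by auto
    have t: "t \<in> pverts T" "t' \<in> pverts T - {t}" using in_arcsD1[OF e(1)] in_arcsD2[OF e(1)] no_loops'[OF e(1)] by auto
    show ?case
    proof (cases "w \<in> P t")
      case True then show ?thesis using Cons.prems(2) t by auto
    next
      case False
      let ?B = "component (parcs T) (pverts T - {t}) t'"
      note cut = td_arc_cut[OF td e(1)]
      have s: "s \<in> ?B" using awalk_in_component[OF awalkI_apath[OF e(2)] e(3)] .
      have tB: "t \<notin> ?B" using component_subset[OF t(2)] by auto
      have "u \<in> P t'" if u: "u \<in> K" for u
      proof -
        have ut: "u \<in> P t" using u Cons.prems(2) by auto
        then have "u \<noteq> w" using False by auto
        then have "(u, w) \<in> td_fill T P" using cl u by (auto simp: clique_def)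
        then obtain b where b: "b \<in> pverts T" "u \<in> P b" "w \<in> P b" by (auto simp: td_fill_def)
        have "b \<in> ?B" using cut[OF s b(1)] b(3) w False by blast
        then show ?thesis using cut[OF _ t(1) tB] b(2) ut by blast
      qed
      then show ?thesis using Cons.IH[OF e(2)] by blast
    qed
  qed
qed

lemma td_clique_in_part:
  assumes td: "tree_decomposition G T P"
    and "finite K" "K \<subseteq> pverts G" "clique (td_fill T P) K"
  shows "\<exists>t\<in>pverts T. K \<subseteq> P t"
  using assms(2-4)
proof (induction K)
  case empty
  \<comment> \<open>Connectedness includes having a node, whose part contains the empty
    clique.\<close>
  have "connected (with_proj T)" using td by (simp add: tree_decomposition_def utree_def)
  then show ?case by (auto simp: connected_def strongly_connected_def)
next
  case (insert w K)
  have T: "utree T" and V: "pverts G = (\<Union>t \<in> pverts T. P t)"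
    using td by (simp_all add: tree_decomposition_def)
  have "clique (td_fill T P) K" using insert.prems(2) clique_subset by blast
  then obtain t where t: "t \<in> pverts T" "K \<subseteq> P t" using insert by auto
  obtain s where s: "s \<in> pverts T" "w \<in> P s" using insert.prems(1) V by auto
  obtain p where "pre_digraph.apath (with_proj T) t p s" using utree_apath_exists[OF T t(1) s(1)] .
  then show ?case using td_extend_clique[OF td _ s(2) t(2) insert.prems(2)] by blast
qed

section \<open>Tree-decomposition from a chordal completion\<close>

context pair_bidirected_digraph
begin

lemma closed_walk_start: "awalk x p x \<Longrightarrow> p \<noteq> [] \<Longrightarrow> x \<in> snd ` set p"
  using closed_walk_ends[of x p] by (cases p) (auto simp: awalk_Cons_iff)

text \<open>Without \<open>(x, y)\<close> the cycle is a walk from \<open>y\<close> to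
  \<open>x\<close> with distinct heads that never returns to \<open>y\<close>. If it used
  \<open>(y, x)\<close>, the closed walks before and after that arc would be empty, and the cycle
  would have only two arcs.\<close>

lemma ucycle_arc_once:
  assumes "ucycle G c" "(x, y) \<in> set c"
  shows "(y, x) \<notin> set c"
proof
  assume yx: "(y, x) \<in> set c"
  obtain u where u: "awalk u c u" "distinct (tl (awalk_verts u c))" "3 \<le> length c"
    using assms(1) by (auto simp: ucycle_def cycle_def)
  have "cas u c u" using u(1) by auto
  then have "tl (awalk_verts u c) = map snd c" using awalk_verts_conv' u(3) by auto
  then have dist: "distinct (map snd c)" using u(2) by simp
  obtain a b where c: "c = a @ (x, y) # b" using split_list[OF assms(2)] by blast
  let ?d = "b @ a"
  have "awalk u a x" "awalk y b u" using u(1) unfolding c by (auto simp: awalk_simps)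
  then have d: "awalk y ?d x" by (rule awalk_appendI[rotated])
  have dist': "distinct (map snd ?d)" "y \<notin> snd ` set ?d" using dist c by auto
  have "x \<noteq> y" using assms(2) u(1) no_loops' by blast
  then have "(y, x) \<in> set ?d" using yx c by auto
  then obtain a' b' where d_eq: "?d = a' @ (y, x) # b'" by (meson split_list)
  have w: "awalk y a' y" "awalk x b' x" using d unfolding d_eq by (auto simp: awalk_simps)
  have "a' = []" using closed_walk_start[OF w(1)] dist'(2) unfolding d_eq by auto
  moreover have "b' = []" using closed_walk_start[OF w(2)] dist'(1) unfolding d_eq by auto
  ultimately have "length ?d = 1" using d_eq by simp
  then show False using u(3) c by simp
qed

lemma ucycle_neighbours:
  assumes "ucycle G c" "v \<in> fst ` set c"
  obtains x y where "(x, v) \<in> set c" "(v, y) \<in> set c" "x \<noteq> y"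
proof -
  obtain u where "awalk u c u" using assms(1) by (auto simp: ucycle_def cycle_def)
  then have "v \<in> snd ` set c" using closed_walk_ends assms(2) by blast
  then show ?thesis using assms that ucycle_arc_once by fastforce
qed

end

text \<open>The nodes have the type over which \<open>treelength\<close> ranges. When parents
  precede their children, the parent is the only smaller neighbour of a node, so arguments can look
  at a largest node.\<close>

definition parent_tree :: "nat \<Rightarrow> (nat \<Rightarrow> nat) \<Rightarrow> nat pair_pre_digraph" where
  "parent_tree n par = \<lparr> pverts = {..n}, parcs = {(i, j). i \<le> n \<and> j \<le> n \<and> (0 < i \<and> j = par i \<or> 0 < j \<and> i = par j)} \<rparr>"

locale parent_function =
  fixes n :: nat and par :: "nat \<Rightarrow> nat"
  assumes par_less: "\<And>i. 0 < i \<Longrightarrow> i \<le> n \<Longrightarrow> par i < i"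
begin

abbreviation T where "T \<equiv> parent_tree n par"

lemma bidirected: "pair_bidirected_digraph T"
proof
  show "symmetric (with_proj T)"
    unfolding symmetric_def with_proj_simps by (auto simp: sym_def parent_tree_def)
  show "fst e \<noteq> snd e" if "e \<in> parcs T" for e
    using that par_less[of "fst e"] par_less[of "snd e"] by (auto simp: parent_tree_def)
qed (auto simp: parent_tree_def)

sublocale T: pair_bidirected_digraph T by (rule bidirected)

lemma parcs_par: "(i, j) \<in> parcs T \<Longrightarrow> i \<le> j \<Longrightarrow> i = par j"
  using par_less[of i] by (auto simp: parent_tree_def)

text \<open>The largest node of a cycle would have two distinct smaller neighbours, both equal to
  its parent. For connectedness, following parents leads every node to 0.\<close>

lemma utree_parent_tree: "utree T"
proof -
  have "\<not> ucycle T c" for c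
  proof
    assume c: "ucycle T c"
    then obtain u where "T.awalk u c u" "c \<noteq> []" by (auto simp: ucycle_def T.cycle_def)
    then have arcs: "set c \<subseteq> parcs T" and ends: "snd ` set c = fst ` set c" and "fst ` set c \<noteq> {}"
      using T.closed_walk_ends[of u c] by auto
    define m where "m = Max (fst ` set c)"
    have m: "m \<in> fst ` set c" "\<And>i. i \<in> fst ` set c \<Longrightarrow> i \<le> m"
      using \<open>fst ` set c \<noteq> {}\<close> by (auto simp: m_def)
    obtain x y where xy: "(x, m) \<in> set c" "(m, y) \<in> set c" "x \<noteq> y"
      using T.ucycle_neighbours[OF c m(1)] .
    have "x \<in> fst ` set c" "y \<in> fst ` set c" using xy ends by force+
    then have "x \<le> m" "y \<le> m" using m(2) by auto
    moreover have "(x, m) \<in> parcs T" "(y, m) \<in> parcs T" using xy arcs T.arcs_symmetric by auto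
    ultimately show False using parcs_par xy(3) by metis
  qed
  moreover have "connected (with_proj T)"
  proof -
    have V: "pverts T = {..n}" by (simp add: parent_tree_def)
    have to_root: "\<exists>p. T.awalk i p 0" if "i \<le> n" for i
      using that
    proof (induction i rule: less_induct)
      case (less i)
      show ?case
      proof (cases "i = 0")
        case True then show ?thesis by (intro exI[of _ "[]"]) (simp add: T.awalk_Nil_iff V)
      next
        case False
        then have "par i < i" using par_less less.prems by simp
        then obtain p where "T.awalk (par i) p 0" using less by (meson less_imp_le order_trans)
        moreover have "(i, par i) \<in> parcs T" using False less.prems \<open>par i < i\<close> by (simp add: parent_tree_def)
        ultimately have "T.awalk i ((i, par i) # p) 0" by (simp add: T.awalk_Cons_iff)
        then show ?thesis by blast
      qed
    qed
    have "\<exists>p. T.awalk i p j" if "i \<le> n" "j \<le> n" for i j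
    proof -
      obtain p q where "T.awalk i p 0" "T.awalk j q 0" using to_root \<open>i \<le> n\<close> \<open>j \<le> n\<close> by meson
      then have "T.awalk i (p @ rev_path q) j" by (intro T.awalk_appendI) simp_all
      then show ?thesis by blast
    qed
    then have "strongly_connected (with_proj T)"
      unfolding strongly_connected_def T.reachable_awalk by (simp add: V)
    then show ?thesis
      unfolding connected_def strongly_connected_def using T.reachable_mk_symmetricI by simp
  qed
  ultimately show ?thesis using bidirected unfolding utree_def uforest_def by blast
qed

text \<open>The largest node of a path has only its parent as a neighbour on the path, hence it is an end
  of the path and can be cut off.\<close>

lemma apath_running_intersection:
  assumes run: "\<And>i j. i \<le> n \<Longrightarrow> j < i \<Longrightarrow> P i \<inter> P j \<subseteq> P (par i)"
    and "T.apath t1 p t3" "t2 \<in> set (pawalk_verts t1 p)"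
  shows "P t1 \<inter> P t3 \<subseteq> P t2"
  using assms(2,3)
proof (induction "length p" arbitrary: p t1 t2 t3 rule: less_induct)
  case less
  \<comment> \<open>A path that starts at its largest node \<open>s1\<close> continues to
    \<open>par s1\<close>, and \<open>run\<close> carries the common elements of the end parts
    there. The length condition admits the reversed path too.\<close>
  have first: "P s1 \<inter> P s3 \<subseteq> P s2"
    if q: "T.apath s1 q s3" "length q = length p" "s2 \<in> set (pawalk_verts s1 q)" "q \<noteq> []"
      and max: "\<And>i. i \<in> set (pawalk_verts s1 q) \<Longrightarrow> i \<le> s1" for s1 q s3 s2
  proof -
    obtain y q' where q_eq: "q = (s1, y) # q'"
      using q(1,4) by (cases q) (auto simp: T.apath_Cons_iff)
    have q': "(s1, y) \<in> parcs T" "T.apath y q' s3" using q(1) by (auto simp: q_eq T.apath_Cons_iff)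
    have "y \<in> set (pawalk_verts s1 q)" 
      using T.hd_in_awalk_verts(2)[OF q'(2)] by (simp add: q_eq)
    then have y: "y = par s1" using parcs_par T.arcs_symmetric q'(1) max by blast
    have "s3 \<in> set (pawalk_verts s1 q)" using T.awalkI_apath[OF q(1)] T.awalkE'
      by (metis T.awalk_verts_non_Nil last_in_set)
    then have "s3 < s1" using max[of s3] T.apath_nonempty_ends[OF q(1,4)] by simp
    moreover have "s1 \<le> n" using T.in_arcsD1[OF q'(1)] by (simp add: parent_tree_def)
    ultimately have "P s1 \<inter> P s3 \<subseteq> P y" using run y by blast
    moreover have "P y \<inter> P s3 \<subseteq> P t" if "t \<in> set (pawalk_verts y q')" for t
      using less.hyps[OF _ q'(2) that] q(2) q_eq by simp
    ultimately show ?thesis using q(3) by (auto simp: q_eq)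
  qed
  show ?case
  proof (cases "p = []")
    case True then show ?thesis using less.prems by (auto simp: T.apath_Nil_iff)
  next
    case False
    note walk = T.awalkI_apath[OF less.prems(1)]
    let ?V = "set (pawalk_verts t1 p)"
    define m where "m = Max ?V"
    have "?V \<noteq> {}" using less.prems(2) by auto
    then have m: "m \<in> ?V" "\<And>i. i \<in> ?V \<Longrightarrow> i \<le> m" by (auto simp: m_def)
    consider "m = t1" | "m = t3" | "m \<noteq> t1" "m \<noteq> t3" by blast
    then show ?thesis
    proof cases
      case 1 then show ?thesis using first[OF less.prems(1) refl less.prems(2) False] m by blast
    next
      case 2
      have rev: "pawalk_verts t3 (rev_path p) = rev (pawalk_verts t1 p)"
        using T.awalk_verts_rev_path[OF walk] .
      have "T.apath t3 (rev_path p) t1" using less.prems(1) by simp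
      from first[OF this, of t2] show ?thesis using rev m less.prems(2) False 2 by auto
    next
      \<comment> \<open>A largest node in the interior would have two distinct neighbours on the
        path, both equal to its parent.\<close>
      case 3
      have "m \<in> snd ` set p" using T.awalk_verts_conv'[of t1 p t3] walk m(1) False 3(1)
        by (cases p) (auto simp: T.awalk_Cons_iff)
      then obtain x where x: "(x, m) \<in> set p" by auto
      obtain p1 y p2 where py: "p = p1 @ (x, m) # (m, y) # p2" "x \<noteq> y"
        using T.apath_succ_decomp[OF less.prems(1) x] 3(2) by metis
      then have "(m, y) \<in> set p" by simp
      then have "x \<in> ?V" "y \<in> ?V"
        using T.awalk_verts_arc1[OF x, of t1] T.awalk_verts_arc2[OF walk] by fastforce+
      moreover have "(x, m) \<in> parcs T" "(m, y) \<in> parcs T" using x \<open>(m, y) \<in> set p\<close> walk by auto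
      ultimately show ?thesis using parcs_par m(2) py(2) T.arcs_symmetric by metis
    qed
  qed
qed

end

text \<open>The clause on all cliques \<open>K\<close> provides the node at which a new simplicial
  vertex is attached, and later yields (T2). The last clause is the running intersection property,
  from which (T3) follows.\<close>

definition elimination_tree :: "'a set \<Rightarrow> 'a rel \<Rightarrow> nat \<Rightarrow> (nat \<Rightarrow> nat) \<Rightarrow> (nat \<Rightarrow> 'a set) \<Rightarrow> bool" where
  "elimination_tree V H n par P \<longleftrightarrow> (\<forall>i. 0 < i \<longrightarrow> i \<le> n \<longrightarrow> par i < i) \<and> (\<Union>i\<le>n. P i) = V \<and>
    (\<forall>i\<le>n. clique H (P i)) \<and> (\<forall>K\<subseteq>V. clique H K \<longrightarrow> (\<exists>i\<le>n. K \<subseteq> P i)) \<and>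
    (\<forall>i j. i \<le> n \<longrightarrow> j < i \<longrightarrow> P i \<inter> P j \<subseteq> P (par i))"

lemma elimination_treeD:
  assumes "elimination_tree V H n par P"
  shows "\<And>i. 0 < i \<Longrightarrow> i \<le> n \<Longrightarrow> par i < i" "(\<Union>i\<le>n. P i) = V" "\<And>i. i \<le> n \<Longrightarrow> clique H (P i)"
    "\<And>K. K \<subseteq> V \<Longrightarrow> clique H K \<Longrightarrow> \<exists>i\<le>n. K \<subseteq> P i"
    "\<And>i j. i \<le> n \<Longrightarrow> j < i \<Longrightarrow> P i \<inter> P j \<subseteq> P (par i)"
  using assms by (simp_all add: elimination_tree_def)

text \<open>Remove a simplicial vertex \<open>v\<close>. Its neighbourhood \<open>N\<close> is a
  clique and lies in some part \<open>P m\<close> of the smaller tree; the new part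
  \<open>insert v N\<close> is hung below \<open>m\<close>.\<close>

lemma chordal_elimination:
  assumes "finite V" "chordal V H" "sym H"
  shows "\<exists>n par P. elimination_tree V H n par P"
  using assms(1,2)
proof (induction V rule: finite_psubset_induct)
  case (psubset V)
  show ?case
  proof (cases "V = {}")
    case True
    \<comment> \<open>Even the empty graph needs a node: a single one with empty part.\<close>
    then show ?thesis
      by (intro exI[of _ 0] exI[of _ id] exI[of _ "\<lambda>_. {}"]) (auto simp: clique_def elimination_tree_def)
  next
    case False
    then obtain v where v: "v \<in> V" and N0: "clique H {y\<in>V. (v, y) \<in> H}"
      using simplicial_vertex_exists[OF psubset.hyps(1) psubset.prems assms(3), of "{}"]
      by (auto simp: clique_def)
    define N where "N = {y\<in>V - {v}. (v, y) \<in> H}"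
    have "V - {v} \<subset> V" using v by auto
    then obtain n par P where "elimination_tree (V - {v}) H n par P"
      using psubset.IH[of "V - {v}"] chordal_subset[OF psubset.prems, of "V - {v}"] by blast
    note IH = elimination_treeD[OF this]
    have "clique H N" by (rule clique_subset[OF N0]) (auto simp: N_def)
    then obtain m where m: "m \<le> n" "N \<subseteq> P m" using IH(4)[of N] by (auto simp: N_def)
    have vN: "clique H (insert v N)" using clique_insert[OF \<open>clique H N\<close> assms(3), of v] by (auto simp: N_def)
    let ?par = "par(Suc n := m)" and ?P = "P(Suc n := insert v N)"
    have "(\<Union>i\<le>n. ?P i) = (\<Union>i\<le>n. P i)" by (rule SUP_cong) simp_all
    then have "(\<Union>i\<le>Suc n. ?P i) = insert v N \<union> (V - {v})" by (simp only: atMost_Suc image_insert Union_insert fun_upd_same IH(2))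
    then have "(\<Union>i\<le>Suc n. ?P i) = V" using v by (auto simp: N_def)
    moreover have "\<exists>i\<le>Suc n. K \<subseteq> ?P i" if K: "K \<subseteq> V" "clique H K" for K
    proof (cases "v \<in> K")
      case True
      then have "K \<subseteq> insert v N" using K by (auto simp: N_def clique_def)
      then show ?thesis by (intro exI[of _ "Suc n"]) simp
    next
      case False
      then have "K \<subseteq> V - {v}" using K(1) by auto
      then obtain i where "i \<le> n" "K \<subseteq> P i" using IH(4)[OF _ K(2)] by metis
      then show ?thesis by (intro exI[of _ i]) simp
    qed
    moreover have "?P i \<inter> ?P j \<subseteq> ?P (?par i)" if ij: "i \<le> Suc n" "j < i" for i j
    proof (cases "i = Suc n")
      case True
      then have "j \<in> {..n}" using ij by simp
      then have "P j \<subseteq> V - {v}" using IH(2) UN_upper[of j "{..n}" P] by simp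
      then have "insert v N \<inter> P j \<subseteq> P m" using m(2) by blast
      then show ?thesis using True ij m(1) by simp
    next
      case False
      then have "par i \<le> n" using IH(1)[of i] ij by auto
      then have "?P (?par i) = P (par i)" "?P i = P i" "?P j = P j" using False ij by simp_all
      then show ?thesis using IH(5)[of i j] False ij by simp
    qed
    moreover have "?par i < i" if "0 < i" "i \<le> Suc n" for i
      using that IH(1)[of i] m(1) by (cases "i = Suc n") simp_all
    moreover have "clique H (?P i)" if "i \<le> Suc n" for i
      using that IH(3)[of i] vN by (cases "i = Suc n") simp_all
    ultimately have "elimination_tree V H (Suc n) ?par ?P"
      unfolding elimination_tree_def by blast
    then show ?thesis by blast
  qed
qed

lemma chordal_tree_decomposition:
  assumes "finite (pverts G)" "chordal (pverts G) H" "sym H" "parcs G \<subseteq> H" 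
    and G: "pair_bidirected_digraph G"
  obtains T :: "nat pair_pre_digraph" and P where "tree_decomposition G T P"
    "\<And>t. t \<in> pverts T \<Longrightarrow> clique H (P t)"
proof -
  interpret pair_bidirected_digraph G by (rule G)
  obtain n par P where "elimination_tree (pverts G) H n par P"
    using chordal_elimination[OF assms(1-3)] by blast
  note e = elimination_treeD[OF this]
  interpret parent_function n par using e(1) by unfold_locales
  have V: "pverts T = {..n}" by (simp add: parent_tree_def)
  have "\<exists>t\<in>pverts T. u \<in> P t \<and> v \<in> P t" if uv: "(u, v) \<in> parcs G" for u v
  proof -
    have "(u, v) \<in> H" "(v, u) \<in> H" using uv assms(3,4) by (auto dest: symD)
    then have "clique H {u, v}" by (auto simp: clique_def)
    moreover have "{u, v} \<subseteq> pverts G" using uv in_arcsD1 in_arcsD2 by auto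
    ultimately show ?thesis using e(4)[of "{u, v}"] by (auto simp: V)
  qed
  moreover have "P t1 \<inter> P t3 \<subseteq> P t2"
    if "T.apath t1 p t3 \<and> t2 \<in> set (pawalk_verts t1 p)" for t1 t2 t3 p
    using apath_running_intersection[of P, OF e(5)] that by blast
  ultimately have "tree_decomposition G T P"
    unfolding tree_decomposition_def V using utree_parent_tree e(2) by auto
  then show ?thesis using that e(3) V by auto
qed

section \<open>The bound on tree-length\<close>

lemma treewidth_lessE:
  fixes G :: "'a pair_pre_digraph"
  assumes G: "pair_graph G" and "treewidth G < int k"
  obtains T :: "nat pair_pre_digraph" and P where "tree_decomposition G T P"
    "\<And>t. t \<in> pverts T \<Longrightarrow> card (P t) \<le> k"
proof -
  interpret pair_graph G by (rule G)
  let ?W = "{td_width T P | (T :: nat pair_pre_digraph) P. tree_decomposition G T P}"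
  let ?H = "{(x, y). x \<noteq> y} :: 'a rel"
  \<comment> \<open>The complete graph is a chordal completion, so some tree-decomposition exists
    and \<open>Inf\<close> is taken over a nonempty set of integers.\<close>
  have "chordal (pverts G) ?H" by (auto simp: chordal_def)
  moreover have "sym ?H" "parcs G \<subseteq> ?H" using no_loops' by (auto simp: sym_def)
  ultimately obtain T :: "nat pair_pre_digraph" and P where "tree_decomposition G T P"
    using chordal_tree_decomposition[of G ?H] finite_verts pair_bidirected_digraph_axioms by blast
  then have "?W \<noteq> {}" by blast
  then obtain T :: "nat pair_pre_digraph" and P where td: "tree_decomposition G T P" "td_width T P < int k"
    using cInf_lessD[of ?W "int k"] assms(2) unfolding treewidth_def by blast
  have sub: "P t \<subseteq> pverts G" if "t \<in> pverts T" for t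
    using td(1) that unfolding tree_decomposition_def by blast
  \<comment> \<open>The tree may be infinite, but the sizes of its parts are bounded, so
    \<open>Max\<close> ranges over a finite set.\<close>
  have "(\<lambda>t. card (P t)) ` pverts T \<subseteq> {..card (pverts G)}"
    using sub card_mono[OF finite_verts] by auto
  then have "finite ((\<lambda>t. card (P t)) ` pverts T)" by (rule finite_subset) simp
  then have "card (P t) \<le> Max ((\<lambda>t. card (P t)) ` pverts T)" if "t \<in> pverts T" for t
    using that by simp
  moreover have "Max ((\<lambda>t. card (P t)) ` pverts T) \<le> k"
    using td(2) by (simp add: td_width_def)
  ultimately show ?thesis using that td(1) order_trans by blast
qed

context pair_graph
begin

lemma fill_edge_gdist:
  assumes mf: "minimal_fill (pverts G) (parcs G) H"
    and card: "\<And>K. clique H K \<Longrightarrow> K \<subseteq> pverts G \<Longrightarrow> card K \<le> k"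
    and geo: "\<And>c. geodesic_cycle G c \<Longrightarrow> length c \<le> l"
    and uv: "(u, v) \<in> H" "u \<noteq> v" "(u, v) \<notin> parcs G"
  shows "gdist G u v \<le> enat (l * (k - 2))"
proof -
  have symE: "sym (parcs G)" using arcs_symmetric by (auto simp: sym_def)
  obtain K C C' where K: "clique H K" "K \<subseteq> pverts G" "nbhd (parcs G) C \<subset> K"
    and C: "linked (parcs G) C" "linked (parcs G) C'" "C \<inter> C' = {}"
    and nb: "{u, v} \<subseteq> nbhd (parcs G) C" "{u, v} \<subseteq> nbhd (parcs G) C'"
    using minimal_fill_separator[OF finite_verts mf symE uv] .
  let ?S = "nbhd (parcs G) C"
  have finK: "finite K" using K(2) finite_verts finite_subset by blast
  then have "card ?S < card K" using K(3) by (rule psubset_card_mono)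
  \<comment> \<open>One unit is lost because \<open>?S\<close> is a proper subset of
    \<open>K\<close>, the other because the growth starts with \<open>u\<close> already
    reached.\<close>
  then have S: "card ?S - 1 \<le> k - 2" using card[OF K(1,2)] by simp
  have "finite ?S" using K(3) finK finite_subset by blast
  then have "gdist G u v \<le> enat (l * (card ?S - 1))"
  proof (rule gdist_le_of_sides_close)
    show "u \<in> ?S" "v \<in> ?S" "u \<in> pverts G" using nb K by auto
    fix A B assume AB: "A \<union> B = ?S" "A \<inter> B = {}" "u \<in> A" "v \<in> B"
    show "\<exists>a\<in>A. \<exists>b\<in>B. gdist G a b \<le> enat l"
      using nbhd_sides_close[OF C AB(1)[symmetric] AB(2-4) nb(2) geo] .
  qed
  also have "\<dots> \<le> enat (l * (k - 2))" using S by simp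
  finally show ?thesis .
qed

text \<open>A cycle traverses its first edge exactly once, hence is odd with respect to that edge
  alone. This serves to obtain \<open>3 \<le> l\<close>.\<close>

lemma ucycle_geodesic_cycle:
  assumes "ucycle G c"
  obtains d where "geodesic_cycle G d"
proof -
  obtain u where u: "awalk u c u" "c \<noteq> []" by (use assms in \<open>auto simp: ucycle_def cycle_def\<close>)
  obtain x y p where c: "c = (x, y) # p" using u(2) by (cases c) auto
  have "(y, x) \<notin> set c" using ucycle_arc_once[OF assms, of x y] c by simp
  moreover have "distinct c"
    using assms distinct_tl_verts_imp_distinct unfolding ucycle_def cycle_def by blast
  ultimately have "set p \<inter> {(x, y), (y, x)} = {}" using c by auto
  then have "oddly_in {(x, y), (y, x)} c" using c oddly_in_disjoint[of p] by simp
  moreover have "sym {(x, y), (y, x)}" by (auto simp: sym_def)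
  ultimately show ?thesis using odd_closed_walk_geodesic_cycle u(1) that by metis
qed

text \<open>In the subgraph of \<open>H\<close> induced by the vertices of the cycle, a simplicial
  vertex has its two neighbours on the cycle joined in \<open>H\<close>. This serves to obtain
  \<open>3 \<le> k\<close>.\<close>

lemma ucycle_chordal_triangle:
  assumes "ucycle G c" "chordal (pverts G) H" "sym H" "parcs G \<subseteq> H"
  obtains K where "clique H K" "K \<subseteq> pverts G" "card K = 3"
proof -
  obtain u where u: "awalk u c u" "c \<noteq> []" using assms(1) by (auto simp: ucycle_def cycle_def)
  let ?W = "fst ` set c"
  have arcs: "set c \<subseteq> parcs G" and ends: "snd ` set c = ?W" using u closed_walk_ends by auto
  have W: "?W \<subseteq> pverts G" using arcs by (intro image_subsetI arc_fst_in_verts) auto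
  obtain v where v: "v \<in> ?W" "clique H {y\<in>?W. (v, y) \<in> H}"
    using simplicial_vertex_exists[of ?W H "{}"] chordal_subset[OF assms(2) W] assms(3) u(2)
    by (auto simp: clique_def)
  obtain x y where xy: "(x, v) \<in> set c" "(v, y) \<in> set c" "x \<noteq> y"
    using ucycle_neighbours[OF assms(1) v(1)] .
  have "x \<in> ?W" "y \<in> ?W" using xy ends by force+
  moreover have E: "(v, x) \<in> parcs G" "(v, y) \<in> parcs G" using xy arcs arcs_symmetric by auto
  ultimately have "(x, y) \<in> H" using v(2) xy(3) assms(4) unfolding clique_def by blast
  then have "clique H {v, x, y}" using E assms(3,4) by (auto simp: clique_def dest: symD)
  moreover have "card {v, x, y} = 3" using E no_loops' xy(3) by auto
  ultimately show ?thesis using that \<open>x \<in> ?W\<close> \<open>y \<in> ?W\<close> v(1) W by blast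
qed

end

theorem theorem1p4:
  fixes G :: "'a pair_pre_digraph" and k l :: nat
  assumes "pair_graph G"
    and "treewidth G < int k"
    and "\<And>c. geodesic_cycle G c \<Longrightarrow> length c \<le> l"
    and "\<not> uforest G"
  shows "treelength G \<le> enat (l * (k - 2))"
proof -
  interpret pair_graph G by (rule assms(1))
  obtain T0 :: "nat pair_pre_digraph" and P0 where td0: "tree_decomposition G T0 P0"
    and bag: "\<And>t. t \<in> pverts T0 \<Longrightarrow> card (P0 t) \<le> k"
    by (rule treewidth_lessE[OF assms(1,2)]) (rule that)
  let ?H0 = "td_fill T0 P0"
  have V0: "P0 t \<subseteq> pverts G" if "t \<in> pverts T0" for t
    using td0 that unfolding tree_decomposition_def by blast
  have "?H0 \<subseteq> pverts G \<times> pverts G" using V0 by (auto simp: td_fill_def)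
  moreover have "parcs G \<subseteq> ?H0"
    using td0 no_loops' unfolding tree_decomposition_def td_fill_def by auto
  ultimately obtain H where mf: "minimal_fill (pverts G) (parcs G) H" and "H \<subseteq> ?H0"
    using minimal_fill_exists[OF finite_verts sym_td_fill _ _ chordal_td_fill[OF td0]] by blast
  have H: "chordal (pverts G) H" "sym H" "parcs G \<subseteq> H" using mf by (auto simp: minimal_fill_def)
  have small: "card K \<le> k" if K: "clique H K" "K \<subseteq> pverts G" for K
  proof -
    have "clique ?H0 K" using K(1) \<open>H \<subseteq> ?H0\<close> by (auto simp: clique_def)
    then obtain t where t: "t \<in> pverts T0" "K \<subseteq> P0 t"
      using td_clique_in_part[OF td0] K(2) finite_verts finite_subset by metis
    have "finite (P0 t)" using V0[OF t(1)] finite_verts finite_subset by blast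
    then have "card K \<le> card (P0 t)" using t(2) by (rule card_mono)
    also have "\<dots> \<le> k" using bag t(1) .
    finally show ?thesis .
  qed
  obtain c where c: "ucycle G c"
    using assms(4) pair_bidirected_digraph_axioms by (auto simp: uforest_def)
  obtain d where d: "geodesic_cycle G d" using ucycle_geodesic_cycle[OF c] .
  \<comment> \<open>That \<open>G\<close> is not a forest makes the bound \<open>l * (k - 2)\<close>
    positive, as is needed for the ends of an arc of \<open>G\<close> in a common part.\<close>
  then have "3 \<le> l" using assms(3)[OF d] by (simp add: geodesic_cycle_def ucycle_def)
  moreover obtain K where "clique H K" "K \<subseteq> pverts G" "card K = 3"
    using ucycle_chordal_triangle[OF c H] .
  then have "3 \<le> k" using small by metis
  ultimately have pos: "1 \<le> l * (k - 2)" by (simp add: Suc_le_eq)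
  have short: "gdist G u v \<le> enat (l * (k - 2))"
    if uv: "u \<in> pverts G" "v \<in> pverts G" "u = v \<or> (u, v) \<in> H" for u v
  proof -
    consider "u = v" | "(u, v) \<in> parcs G" | "u \<noteq> v" "(u, v) \<in> H" "(u, v) \<notin> parcs G" using uv by blast
    then show ?thesis
    proof cases
      case 1
      have "gdist G u v \<le> enat (length ([] :: ('a \<times> 'a) list))"
        by (rule gdist_le_length) (use 1 uv in \<open>simp add: awalk_Nil_iff\<close>)
      then show ?thesis by (rule order_trans) simp
    next
      case 2
      have "gdist G u v \<le> enat (length [(u, v)])"
        by (rule gdist_le_length) (use 2 uv in \<open>simp add: awalk_simps\<close>)
      then show ?thesis by (rule order_trans) (use pos in simp)
    next
      case 3 then show ?thesis using fill_edge_gdist[OF mf small assms(3)] by blast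
    qed
  qed
  obtain T :: "nat pair_pre_digraph" and P where td: "tree_decomposition G T P"
    and cl: "\<And>t. t \<in> pverts T \<Longrightarrow> clique H (P t)"
    by (rule chordal_tree_decomposition[OF finite_verts H pair_bidirected_digraph_axioms]) (rule that)
  have "gdist G u v \<le> enat (l * (k - 2))" if t: "t \<in> pverts T" "u \<in> P t" "v \<in> P t" for t u v
  proof (rule short)
    show "u \<in> pverts G" "v \<in> pverts G" using td t unfolding tree_decomposition_def by blast+
    show "u = v \<or> (u, v) \<in> H" using cl[OF t(1)] t(2,3) by (auto simp: clique_def)
  qed
  then have "td_length G T P \<le> enat (l * (k - 2))"
    unfolding td_length_def by (intro SUP_least)
  moreover have "treelength G \<le> td_length G T P"
    unfolding treelength_def using td by (intro Inf_lower) blast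
  ultimately show ?thesis by (rule order_trans[rotated])
qed

end
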